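(* Let $n\ge1$, let $k\in\{0,1,\dots,n\}$ and let $\nu$ be a (non-negative) Radon measure on $\mathbb{R}$ such that $\int_{(0,\infty)}t^k\,d\nu(t)<\infty$. Then the map $\mu:\mathcal{C}^n\to\mathbb{R}$ defined by $$\mu(u)=\int_{\mathbb{R}}V_k(\mathrm{cl}(\{u<t\}))\,d\nu(t),\qquad u\in\mathcal{C}^n,$$ has the following properties: (i) it is a valuation; (ii) it is rigid motion invariant; (iii) it is monotone (decreasing); (iv) it is $k$-homogeneous; (v) it is m-continuous.
   Context: $\mathcal{C}^n$ is the set of all convex, lower semi-continuous functions $u:\mathbb{R}^n\to\mathbb{R}\cup\{\infty\}$ with $\lim_{|x|\to\infty}u(x)=\infty$; it contains the function $\boldsymbol{\infty}$ identically equal to $\infty$. $\mathrm{dom}(u)=\{x: u(x)<\infty\}$. $u\vee v$ and $u\wedge v$ denote pointwise maximum and minimum. A valuation on $\mathcal{C}^n$ is a map $\mu:\mathcal{C}^n\to\mathbb{R}$ with $\mu(\boldsymbol{\infty})=0$ and $\mu(u\vee v)+\mu(u\wedge v)=\mu(u)+\mu(v)$ for all $u,v\in\mathcal{C}^n$ such that $u\wedge v\in\mathcal{C}^n$. It is: - rigid motion invariant if $\mu(u\circ T)=\mu(u)$ for all $u\in\mathcal{C}^n$ and all rigid motions $T$ (maps $T(x)=Rx+x_0$ with $R\in\mathbf{O}(n)$, $x_0\in\mathbb{R}^n$); - monotone (decreasing) if $\mu(u)\le\mu(v)$ whenever $u\ge v$ pointwise in $\mathbb{R}^n$; - m-continuous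 if $\lim_{i\to\infty}\mu(u_i)=\mu(u)$ whenever $u,u_i\in\mathcal{C}^n$ satisfy $u_i\ge u_{i+1}\ge u$ in $\mathbb{R}^n$ for every $i$ and $u_i(x)\to u(x)$ for every $x$ in the relative interior of $\mathrm{dom}(u)$; - $k$-homogeneous if $\mu(u_\lambda)=\lambda^k\mu(u)$ for all $u\in\mathcal{C}^n$, $\lambda>0$, where $u_\lambda(x)=u(x/\lambda)$. $V_0,\dots,V_n$ are the intrinsic volumes of compact convex subsets of $\mathbb{R}^n$ (with $V_k(\emptyset)=0$); $\{u<t\}=\{x:u(x)<t\}$ is a bounded convex set and $\mathrm{cl}$ denotes closure. *)

theory Defs
  imports "HOL-Analysis.Analysis"
begin

text \<open>Functions with values in \<open>\<real> \<union> {\<infinity>}\<close> are \<open>ereal\<close>-valued functions avoiding \<open>-\<infinity>\<close>.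
  Restricting the convexity inequality to weights in the open interval \<open>(0,1)\<close> avoids the
  products \<open>0 * \<infinity>\<close>.\<close>

definition ereal_convex :: "('a::real_vector \<Rightarrow> ereal) \<Rightarrow> bool" where
  "ereal_convex u \<longleftrightarrow>
     (\<forall>x y. \<forall>s\<in>{0<..<1::real}.
        u (s *\<^sub>R x + (1 - s) *\<^sub>R y) \<le> ereal s * u x + ereal (1 - s) * u y)"

definition lower_semicontinuous :: "('a::topological_space \<Rightarrow> ereal) \<Rightarrow> bool" where
  "lower_semicontinuous u \<longleftrightarrow> (\<forall>x. u x \<le> Liminf (at x) u)"

definition conv_funs :: "(real^'n \<Rightarrow> ereal) set" where
  "conv_funs = {u. (\<forall>x. u x \<noteq> -\<infinity>) \<and> ereal_convex u \<and> lower_semicontinuous u \<and>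
                   (u \<longlongrightarrow> \<infinity>) at_infinity}"

definition eff_dom :: "('a \<Rightarrow> ereal) \<Rightarrow> 'a set" where
  "eff_dom u = {x. u x < \<infinity>}"

text \<open>A functional is a total function, of which only the values on \<^const>\<open>conv_funs\<close> matter.\<close>

definition valuation :: "((real^'n \<Rightarrow> ereal) \<Rightarrow> real) \<Rightarrow> bool" where
  "valuation \<mu> \<longleftrightarrow>
     \<mu> (\<lambda>x. \<infinity>) = 0 \<and>
     (\<forall>u\<in>conv_funs. \<forall>v\<in>conv_funs. (\<lambda>x. min (u x) (v x)) \<in> conv_funs \<longrightarrow>
        \<mu> (\<lambda>x. max (u x) (v x)) + \<mu> (\<lambda>x. min (u x) (v x)) = \<mu> u + \<mu> v)"

definition rigid_motion :: "(real^'n \<Rightarrow> real^'n) \<Rightarrow> bool" where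
  "rigid_motion T \<longleftrightarrow> (\<exists>R x0. orthogonal_matrix R \<and> T = (\<lambda>x. R *v x + x0))"

definition rigid_motion_invariant :: "((real^'n \<Rightarrow> ereal) \<Rightarrow> real) \<Rightarrow> bool" where
  "rigid_motion_invariant \<mu> \<longleftrightarrow>
     (\<forall>u\<in>conv_funs. \<forall>T. rigid_motion T \<longrightarrow> \<mu> (u \<circ> T) = \<mu> u)"

definition monotone_decreasing :: "((real^'n \<Rightarrow> ereal) \<Rightarrow> real) \<Rightarrow> bool" where
  "monotone_decreasing \<mu> \<longleftrightarrow>
     (\<forall>u\<in>conv_funs. \<forall>v\<in>conv_funs. (\<forall>x. u x \<ge> v x) \<longrightarrow> \<mu> u \<le> \<mu> v)"

definition homogeneous_of_degree :: "nat \<Rightarrow> ((real^'n \<Rightarrow> ereal) \<Rightarrow> real) \<Rightarrow> bool" where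
  "homogeneous_of_degree k \<mu> \<longleftrightarrow>
     (\<forall>u\<in>conv_funs. \<forall>c>0. \<mu> (\<lambda>x. u (x /\<^sub>R c)) = c ^ k * \<mu> u)"

definition m_continuous :: "((real^'n \<Rightarrow> ereal) \<Rightarrow> real) \<Rightarrow> bool" where
  "m_continuous \<mu> \<longleftrightarrow>
     (\<forall>u\<in>conv_funs. \<forall>U :: nat \<Rightarrow> real^'n \<Rightarrow> ereal.
        (\<forall>i. U i \<in> conv_funs) \<longrightarrow>
        (\<forall>i x. U i x \<ge> U (Suc i) x \<and> U (Suc i) x \<ge> u x) \<longrightarrow>
        (\<forall>x\<in>rel_interior (eff_dom u). (\<lambda>i. U i x) \<longlonglongrightarrow> u x) \<longrightarrow>
        (\<lambda>i. \<mu> (U i)) \<longlonglongrightarrow> \<mu> u)"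

text \<open>The intrinsic volumes \<open>V\<^sub>0, \<dots>, V\<^sub>n\<close> of a compact convex set \<open>K\<close> in \<open>\<real>\<^sup>n\<close> are the numbers
  in the Steiner formula: for all \<open>r \<ge> 0\<close>, the volume of the parallel body \<open>K + r B\<close> is
  \<open>\<Sum>j\<le>n. \<kappa>\<^bsub>n-j\<^esub> r\<^bsup>n-j\<^esup> V\<^sub>j(K)\<close>, with \<open>B\<close> the closed unit ball and \<open>\<kappa>\<^sub>i\<close> the volume of the
  \<open>i\<close>-dimensional unit ball. The remaining entries of the sequence are fixed to \<open>0\<close> to make it
  unique.\<close>

definition steiner_coeffs :: "(real^'n) set \<Rightarrow> (nat \<Rightarrow> real) \<Rightarrow> bool" where
  "steiner_coeffs K V \<longleftrightarrow>
     (\<forall>j>CARD('n). V j = 0) \<and>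
     (\<forall>r\<ge>0. measure lebesgue (\<Union>x\<in>K. cball x r) =
        (\<Sum>j\<le>CARD('n). unit_ball_vol (real (CARD('n) - j)) * r ^ (CARD('n) - j) * V j))"

definition intrinsic_volume :: "nat \<Rightarrow> (real^'n) set \<Rightarrow> real" where
  "intrinsic_volume k K = (THE V. steiner_coeffs K V) k"

lemma steiner_coeffs_unique:
  fixes K :: "(real^'n) set"
  assumes V: "steiner_coeffs K V" and W: "steiner_coeffs K W"
  shows "V = W"
proof
  fix i
  let ?n = "CARD('n)"
  define c where "c j = unit_ball_vol (real j) * (V (?n - j) - W (?n - j))" for j
  have poly0: "(\<Sum>j\<le>?n. c j * r ^ j) = 0" if "r \<ge> 0" for r
  proof -
    have "(\<Sum>j\<le>?n. c j * r ^ j) = (\<Sum>j\<le>?n. c (?n - j) * r ^ (?n - j))"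
      by (rule sum.reindex_bij_witness[of _ "\<lambda>j. ?n - j" "\<lambda>j. ?n - j"]) auto
    also have "\<dots> = (\<Sum>j\<le>?n. unit_ball_vol (real (?n - j)) * r ^ (?n - j) * V j)
                 - (\<Sum>j\<le>?n. unit_ball_vol (real (?n - j)) * r ^ (?n - j) * W j)"
      unfolding sum_subtractf[symmetric]
      by (rule sum.cong[OF refl]) (simp add: c_def algebra_simps)
    also have "\<dots> = 0"
      using V W that by (simp add: steiner_coeffs_def)
    finally show ?thesis .
  qed
  have "infinite {r::real. (\<Sum>j\<le>?n. c j * r ^ j) = 0}"
    by (rule infinite_super[OF _ infinite_Ici[of "0::real"]]) (simp add: poly0 subset_eq)
  then have c0: "c j = 0" if "j \<le> ?n" for j
    using polyfun_finite_roots[of c ?n] that by simp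
  show "V i = W i"
  proof (cases "i \<le> ?n")
    case True
    then show ?thesis
      using c0[of "?n - i"] less_imp_neq[OF unit_ball_vol_pos[of "real (?n - i)"]]
      by (simp add: c_def del: of_nat_diff)
  next
    case False
    then show ?thesis using V W by (auto simp: steiner_coeffs_def)
  qed
qed

lemma intrinsic_volume_eq:
  assumes "steiner_coeffs K V"
  shows "intrinsic_volume k K = V k"
proof -
  have "(THE V. steiner_coeffs K V) = V"
    by (rule the_equality, rule assms, erule steiner_coeffs_unique[OF _ assms])
  then show ?thesis by (simp add: intrinsic_volume_def)
qed

lemma intrinsic_volume_empty: "intrinsic_volume k {} = 0"
  by (subst intrinsic_volume_eq[where V = "\<lambda>_. 0"]) (auto simp: steiner_coeffs_def)

definition radon_measure :: "'a::topological_space measure \<Rightarrow> bool" where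
  "radon_measure \<nu> \<longleftrightarrow>
     sets \<nu> = sets borel \<and>
     (\<forall>K. compact K \<longrightarrow> emeasure \<nu> K < \<infinity>) \<and>
     (\<forall>A\<in>sets \<nu>. emeasure \<nu> A = (SUP K\<in>{K. compact K \<and> K \<subseteq> A}. emeasure \<nu> K))"

end

theory Submission
  imports Defs
begin

text \<open>
  The key point is that the coefficients of the Steiner polynomial exist and are monotone in the
  convex body. For a segment \<open>[0, v]\<close> the volume of \<open>K + r [0, v]\<close> is affine in \<open>r\<close>, and its slope is
  again a functional that is affine along segments and monotone in \<open>K\<close>. Iterating, the volume of
  \<open>K + r Z\<close> for a zonotope \<open>Z\<close> is a polynomial in \<open>r\<close> whose coefficients are monotone in \<open>K\<close>. The unit
  ball is a limit of zonotopes, and polynomials of bounded degree converge coefficientwise, so the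
  same holds for \<open>K + r B\<close>.

  Additivity, invariance, homogeneity and continuity along increasing unions of the intrinsic volumes
  then follow from the uniqueness of the coefficients. For the functional \<open>\<mu>\<close> they are applied to
  the sublevel sets pointwise in \<open>t\<close>; sublevel sets have radius \<open>O(t)\<close>, which gives integrability,
  and dominated convergence gives m-continuity.
\<close>

text \<open>\<open>intrinsic_volume\<close> selects coefficients by a definite description, so
  nothing is known about it until a Steiner polynomial is shown to exist. Uniqueness then transfers
  identities between volumes of parallel bodies to the coefficients, but not inequalities: p \<le> q
  on [0, \<infinity>) does not compare intermediate coefficients. Building the polynomial one
  segment at a time makes every coefficient a sum of iterated slopes, and slopes of affine functions
  do inherit inequalities. The price is that the polynomial of a zonotope has the number of
  generators as its formal degree, which is not controlled along the approximation. Since the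
  coefficients are non-negative, the growth of order r^n of the volume removes the surplus. Rotation
  invariance of Lebesgue measure is used twice: to see that averaging segments over the ball yields
  a ball, and for rigid motions. Strict sublevel sets matter for m-continuity: the closures of {U_i
  < t} exhaust that of {u < t} for every t, while at t = min u the sets {U_i \<le> t} may all be
  empty.\<close>

section \<open>Orthogonal invariance of Lebesgue measure\<close>

text \<open>The library proves invariance of Lebesgue measure under orthogonal maps only for well-ordered
  index types; an arbitrary finite index type is in bijection with the following well-ordered one.\<close>

typedef (overloaded) 'n ordered_index = "{..<CARD('n::finite)}"
  by (rule exI[of _ 0]) simp

instantiation ordered_index :: (finite) "{finite, wellorder}"
begin

definition less_eq_ordered_index :: "'a ordered_index \<Rightarrow> 'a ordered_index \<Rightarrow> bool" where
  "less_eq_ordered_index i j \<longleftrightarrow> Rep_ordered_index i \<le> Rep_ordered_index j"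

definition less_ordered_index :: "'a ordered_index \<Rightarrow> 'a ordered_index \<Rightarrow> bool" where
  "less_ordered_index i j \<longleftrightarrow> Rep_ordered_index i < Rep_ordered_index j"

instance
proof
  show "finite (UNIV :: 'a ordered_index set)"
    by (metis finite_imageI finite_lessThan type_definition.Abs_image
          type_definition_ordered_index)
  fix P :: "'a ordered_index \<Rightarrow> bool" and i
  assume step: "\<And>i. (\<And>j. j < i \<Longrightarrow> P j) \<Longrightarrow> P i"
  show "P i"
    by (induction i rule: measure_induct_rule[of Rep_ordered_index])
       (rule step, simp add: less_ordered_index_def)
qed (auto simp: less_eq_ordered_index_def less_ordered_index_def Rep_ordered_index_inject)

end

lemma card_ordered_index: "CARD('n::finite ordered_index) = CARD('n)"
  using type_definition.card[OF type_definition_ordered_index] by simp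

text \<open>Push-forwards compose and transform integrals directly; both are used below.\<close>

lemma lborel_distr_orthogonal_wellorder:
  fixes T :: "real^'m::{finite,wellorder} \<Rightarrow> real^'m::_"
  assumes "orthogonal_transformation T"
  shows "distr lborel borel T = lborel"
proof (rule lborel_eqI[symmetric])
  fix l u :: "real^'m::_"
  assume lu: "\<And>b. b \<in> Basis \<Longrightarrow> l \<bullet> b \<le> u \<bullet> b"
  have inv: "orthogonal_transformation (inv T)" and bij: "bij T"
    using assms orthogonal_transformation_inv orthogonal_transformation_bij by auto
  have [measurable]: "T \<in> borel_measurable borel"
    using assms orthogonal_transformation_linear linear_continuous_on
      borel_measurable_continuous_onI linear_conv_bounded_linear by blast
  have eq: "T -` box l u = inv T ` box l u"
    using bij bij_vimage_eq_inv_image by blast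
  have meas: "T -` box l u \<in> sets borel"
    using measurable_sets[of T borel borel "box l u"] by simp
  have lm: "inv T ` box l u \<in> lmeasurable"
    using measurable_orthogonal_image[OF inv] by simp
  have "emeasure (distr lborel borel T) (box l u) = emeasure lborel (T -` box l u)"
    by (simp add: emeasure_distr)
  also have "\<dots> = emeasure lebesgue (inv T ` box l u)"
    using meas eq by simp
  also have "\<dots> = measure lebesgue (inv T ` box l u)"
    using lm by (simp add: emeasure_eq_measure2)
  also have "\<dots> = measure lebesgue (box l u)"
    by (simp add: measure_orthogonal_image[OF inv])
  also have "ennreal (measure lebesgue (box l u)) = emeasure lborel (box l u)"
    using emeasure_eq_measure2[OF lmeasurable_box[of l u]] by simp
  also have "\<dots> = (\<Prod>b\<in>Basis. (u - l) \<bullet> b)"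
    using lu by (simp add: emeasure_lborel_box inner_diff_left)
  finally show "emeasure (distr lborel borel T) (box l u) = (\<Prod>b\<in>Basis. (u - l) \<bullet> b)" .
qed simp

lemma lborel_distr_reindex:
  fixes f :: "'m::finite \<Rightarrow> 'n::finite"
  assumes "bij f"
  shows "distr lborel borel (\<lambda>x::real^'n. (\<chi> i. x $ f i) :: real^'m) = lborel"
proof (rule lborel_eqI[symmetric])
  define P where "P = (\<lambda>x::real^'n. (\<chi> i. x $ f i) :: real^'m)"
  have lin: "linear P"
    by (auto simp: P_def linear_iff vec_eq_iff)
  have [measurable]: "P \<in> borel_measurable borel"
    by (intro borel_measurable_continuous_onI linear_continuous_on)
       (use lin linear_conv_bounded_linear in blast)
  fix l u :: "real^'m"
  assume lu: "\<And>b. b \<in> Basis \<Longrightarrow> l \<bullet> b \<le> u \<bullet> b"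
  have lu': "l $ i \<le> u $ i" for i
    using lu[of "axis i 1"] by (simp add: inner_axis)
  define g where "g = inv f"
  have fg: "f (g i) = i" "g (f j) = j" for i j
    using assms by (simp_all add: g_def bij_is_surj surj_f_inv_f bij_is_inj)
  have eq: "P -` box l u = box (\<chi> i. l $ g i) (\<chi> i. u $ g i)"
    unfolding P_def by (auto simp: mem_box_cart) (metis fg)+
  have "emeasure (distr lborel borel P) (box l u) = emeasure lborel (P -` box l u)"
    by (simp add: emeasure_distr)
  also have "\<dots> = (\<Prod>b\<in>Basis. ((\<chi> i. u $ g i) - (\<chi> i. l $ g i)) \<bullet> b)"
    unfolding eq by (subst emeasure_lborel_box) (auto simp: Basis_vec_def inner_axis lu')
  also have "\<dots> = (\<Prod>i\<in>UNIV. u $ g i - l $ g i)"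
    by (simp add: Basis_vec_def UNION_singleton_eq_range prod.reindex inj_on_def axis_eq_axis inner_axis)
  also have "\<dots> = (\<Prod>i\<in>UNIV. u $ i - l $ i)"
    by (rule arg_cong[where f = ennreal], rule prod.reindex_bij_witness[where i = f and j = g])
       (auto simp: fg)
  also have "\<dots> = (\<Prod>b\<in>Basis. (u - l) \<bullet> b)"
    by (simp add: Basis_vec_def UNION_singleton_eq_range prod.reindex inj_on_def axis_eq_axis inner_axis)
  finally show "emeasure (distr lborel borel (\<lambda>x::real^'n. (\<chi> i. x $ f i) :: real^'m)) (box l u)
     = (\<Prod>b\<in>Basis. (u - l) \<bullet> b)" unfolding P_def .
qed simp

lemma lborel_distr_orthogonal:
  fixes T :: "real^'n \<Rightarrow> real^'n"
  assumes T: "orthogonal_transformation T"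
  shows "distr lborel borel T = lborel"
proof -
  obtain f :: "'n ordered_index \<Rightarrow> 'n" where f: "bij f"
    using finite_same_card_bij[of "UNIV :: 'n ordered_index set" "UNIV :: 'n set"]
    by (auto simp: card_ordered_index)
  define g where "g = inv f"
  have g: "bij g" using f g_def bij_imp_bij_inv by auto
  have fg: "f (g i) = i" "g (f j) = j" for i j
    using f by (simp_all add: g_def bij_is_surj surj_f_inv_f bij_is_inj)
  define P where "P = (\<lambda>x::real^'n. (\<chi> i. x $ f i) :: real^'n ordered_index)"
  define Q where "Q = (\<lambda>x::real^'n ordered_index. (\<chi> i. x $ g i) :: real^'n)"
  have PQ: "P (Q x) = x" "Q (P y) = y" for x y
    by (simp_all add: P_def Q_def fg)
  have lin: "linear P" "linear Q"
    by (auto simp: P_def Q_def linear_iff vec_eq_iff)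
  have inner: "Q x \<bullet> Q y = x \<bullet> y" "P z \<bullet> P w = z \<bullet> w" for x y z w
    unfolding inner_vec_def P_def Q_def
    by (simp_all, rule sum.reindex_bij_witness[of _ f g], simp_all add: fg,
        rule sum.reindex_bij_witness[of _ g f], simp_all add: fg)
  \<comment> \<open>\<open>P\<close> and \<open>Q\<close> are mutually inverse relabelings of
    coordinates that preserve inner products, so the conjugate \<open>S\<close> of \<open>T\<close>
    is orthogonal over the well-ordered index type.\<close>
  define S where "S = P \<circ> T \<circ> Q"
  have "orthogonal_transformation S"
    using T lin unfolding S_def orthogonal_transformation_def
    by (auto simp: inner intro!: linear_compose)
  then have S: "distr lborel borel S = lborel"
    by (rule lborel_distr_orthogonal_wellorder)
  have m: "h \<in> borel_measurable borel" if "linear h" for h :: "real^'a \<Rightarrow> real^'b"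
    using that linear_continuous_on borel_measurable_continuous_onI
      linear_conv_bounded_linear by blast
  have linT: "linear T" using T by (rule orthogonal_transformation_linear)
  have linS: "linear S" using lin linT by (simp add: S_def linear_compose)
  note [measurable] = m[OF lin(1)] m[OF lin(2)] m[OF linT] m[OF linS]
  have "T = Q \<circ> S \<circ> P" by (auto simp: S_def PQ fun_eq_iff)
  then have "distr lborel borel T = distr (distr (distr lborel borel P) borel S) borel Q"
    by (simp add: distr_distr comp_def)
  also have "\<dots> = lborel"
    using lborel_distr_reindex[OF f] lborel_distr_reindex[OF g] S by (simp add: P_def Q_def)
  finally show ?thesis .
qed

section \<open>Adding segments to a convex body\<close>

text \<open>The empty set is included: comparison with it turns monotonicity into non-negativity,
  and sublevel sets at low levels are empty.\<close>

definition compact_convex :: "'a::euclidean_space set \<Rightarrow> bool" where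
  "compact_convex K \<longleftrightarrow> compact K \<and> convex K"

abbreviation segment :: "'a::euclidean_space \<Rightarrow> 'a set" where
  "segment v \<equiv> closed_segment 0 v"

lemma compact_convex_plus:
  assumes "compact_convex K" "compact_convex L"
  shows "compact_convex (K + L)"
proof -
  have "K + L = {x + y |x y. x \<in> K \<and> y \<in> L}"
    by (auto simp: set_plus_def)
  then have "compact (K + L)"
    using compact_sums assms by (auto simp: compact_convex_def)
  then show ?thesis
    using convex_set_plus assms by (auto simp: compact_convex_def)
qed

lemma compact_convex_segment: "compact_convex (segment v)"
  by (simp add: compact_convex_def)

lemma compact_convex_plus_segment: "compact_convex K \<Longrightarrow> compact_convex (K + segment v)"
  by (rule compact_convex_plus[OF _ compact_convex_segment])

lemma compact_convex_lmeasurable: "compact_convex K \<Longrightarrow> K \<in> lmeasurable"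
  by (auto simp: compact_convex_def lmeasurable_compact)

lemma set_plus_mono_left: "A \<subseteq> B \<Longrightarrow> A + C \<subseteq> B + C"
  by (auto simp: set_plus_def)

lemma mem_plus_segment_iff:
  assumes "a \<ge> 0"
  shows "y \<in> K + segment (a *\<^sub>R v) \<longleftrightarrow> (\<exists>k\<in>K. \<exists>t. 0 \<le> t \<and> t \<le> a \<and> y = k + t *\<^sub>R v)"
proof -
  have "z \<in> segment (a *\<^sub>R v) \<longleftrightarrow> (\<exists>t. 0 \<le> t \<and> t \<le> a \<and> z = t *\<^sub>R v)" for z
  proof (cases "a = 0")
    case False
    show ?thesis
    proof
      assume "z \<in> segment (a *\<^sub>R v)"
      then obtain u where "0 \<le> u" "u \<le> 1" "z = u *\<^sub>R a *\<^sub>R v"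
        by (auto simp: closed_segment_def)
      then show "\<exists>t. 0 \<le> t \<and> t \<le> a \<and> z = t *\<^sub>R v"
        using assms by (intro exI[of _ "u * a"]) (auto simp: mult_left_le_one_le)
    next
      assume "\<exists>t. 0 \<le> t \<and> t \<le> a \<and> z = t *\<^sub>R v"
      then obtain t where "0 \<le> t" "t \<le> a" "z = t *\<^sub>R v" by blast
      then show "z \<in> segment (a *\<^sub>R v)"
        using False assms unfolding closed_segment_def
        by (intro CollectI exI[of _ "t / a"]) auto
    qed
  qed (auto intro: exI[of _ 0])
  then show ?thesis
    by (auto simp: set_plus_def) blast+
qed

text \<open>Along each line in direction \<open>v\<close> that meets \<open>K\<close> the set \<open>K + [0, r v]\<close> is an interval whose
  lower end does not depend on \<open>r\<close>.\<close>

lemma plus_segment_diff: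
  assumes "convex K" "r \<ge> 0" "s \<ge> 0"
  shows "(K + segment ((r + s) *\<^sub>R v)) - (K + segment (r *\<^sub>R v))
       = (+) (r *\<^sub>R v) ` ((K + segment (s *\<^sub>R v)) - K)"
proof (intro equalityI subsetI)
  fix x assume x: "x \<in> (K + segment ((r + s) *\<^sub>R v)) - (K + segment (r *\<^sub>R v))"
  then obtain k t where k: "k \<in> K" "0 \<le> t" "t \<le> r + s" "x = k + t *\<^sub>R v"
    using assms by (auto simp: mem_plus_segment_iff)
  have "t > r"
    using x k mem_plus_segment_iff[OF assms(2), of x K v] not_le by blast
  then have "x - r *\<^sub>R v \<in> K + segment (s *\<^sub>R v)"
    using k unfolding mem_plus_segment_iff[OF assms(3)]
    by (intro bexI[of _ k] exI[of _ "t - r"]) (auto simp: algebra_simps)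
  moreover have "x - r *\<^sub>R v \<notin> K"
  proof
    assume "x - r *\<^sub>R v \<in> K"
    then have "x \<in> K + segment (r *\<^sub>R v)"
      unfolding mem_plus_segment_iff[OF assms(2)] using assms(2)
      by (intro bexI[of _ "x - r *\<^sub>R v"] exI[of _ r]) auto
    then show False using x by simp
  qed
  ultimately show "x \<in> (+) (r *\<^sub>R v) ` ((K + segment (s *\<^sub>R v)) - K)"
    by (intro image_eqI[of _ _ "x - r *\<^sub>R v"]) auto
next
  fix x assume "x \<in> (+) (r *\<^sub>R v) ` ((K + segment (s *\<^sub>R v)) - K)"
  then obtain k t where k: "k \<in> K" "0 \<le> t" "t \<le> s" "k + t *\<^sub>R v \<notin> K"
      "x = k + (r + t) *\<^sub>R v"
    using assms by (auto simp: mem_plus_segment_iff algebra_simps)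
  have "x \<notin> K + segment (r *\<^sub>R v)"
  proof
    assume "x \<in> K + segment (r *\<^sub>R v)"
    then obtain l q where l: "l \<in> K" "0 \<le> q" "q \<le> r" "x = l + q *\<^sub>R v"
      using assms by (auto simp: mem_plus_segment_iff)
    then have eq: "l = k + (r + t - q) *\<^sub>R v"
      using k by (simp add: algebra_simps)
    \<comment> \<open>Equality would force t = 0, and then \<open>k + t *\<^sub>R v\<close> is
      \<open>k\<close> itself, which lies in \<open>K\<close>.\<close>
    have pos: "r + t - q > 0"
      using k l by (cases "r + t - q = 0") auto
    \<comment> \<open>Since q \<le> r, the point \<open>k + t *\<^sub>R v\<close> lies on the
      segment from \<open>k\<close> to \<open>l\<close>, at the fraction \<open>w\<close>.\<close>
    define w where "w = t / (r + t - q)"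
    have w: "0 \<le> w" "w \<le> 1" "w * (r + t - q) = t"
      using pos k l by (auto simp: w_def)
    have "(1 - w) *\<^sub>R k + w *\<^sub>R l = k + (w * (r + t - q)) *\<^sub>R v"
      by (simp add: eq algebra_simps)
    then have "k + t *\<^sub>R v = (1 - w) *\<^sub>R k + w *\<^sub>R l"
      by (simp only: w(3))
    also have "\<dots> \<in> K"
      using w k l by (intro convexD_alt[OF \<open>convex K\<close>]) auto
    finally show False using k by simp
  qed
  moreover have "x \<in> K + segment ((r + s) *\<^sub>R v)"
    using k assms mem_plus_segment_iff[of "r + s" x K v]
    by (auto intro!: bexI[of _ k] exI[of _ "r + t"])
  ultimately show "x \<in> (K + segment ((r + s) *\<^sub>R v)) - (K + segment (r *\<^sub>R v))" by simp
qed

text \<open>Cauchy's functional equation on a half-line. Non-negativity makes f monotone; placing n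
  r between consecutive integers bounds n times the error by f 1 for every n, so the error is
  0.\<close>

lemma additive_nonneg_imp_linear:
  fixes f :: "real \<Rightarrow> real"
  assumes add: "\<And>r s. r \<ge> 0 \<Longrightarrow> s \<ge> 0 \<Longrightarrow> f (r + s) = f r + f s"
    and nonneg: "\<And>r. r \<ge> 0 \<Longrightarrow> f r \<ge> 0" and "r \<ge> 0"
  shows "f r = r * f 1"
proof -
  have mult: "f (real n * s) = real n * f s" if "s \<ge> 0" for n s
  proof (induction n)
    case 0
    then show ?case using add[of 0 0] by simp
  next
    case (Suc n)
    then show ?case using add[of "real n * s" s] that by (simp add: algebra_simps)
  qed
  have mono: "f a \<le> f b" if "0 \<le> a" "a \<le> b" for a b
    using add[of a "b - a"] nonneg[of "b - a"] that by simp
  have bound: "real n * \<bar>f r - r * f 1\<bar> \<le> f 1" for n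
  proof -
    define m where "m = nat \<lfloor>real n * r\<rfloor>"
    have m: "real m \<le> real n * r" "real n * r \<le> real (Suc m)"
      using \<open>r \<ge> 0\<close> by (auto simp: m_def) linarith
    have "real m * f 1 \<le> real n * f r" "real n * f r \<le> real (Suc m) * f 1"
      using mono[of "real m" "real n * r"] mono[of "real n * r" "real (Suc m)"] m \<open>r \<ge> 0\<close>
        mult[of 1 m] mult[of 1 "Suc m"] mult[of r n] by auto
    moreover have "real m * f 1 \<le> real n * r * f 1" "real n * r * f 1 \<le> real (Suc m) * f 1"
      using m nonneg[of 1] by (auto intro!: mult_right_mono simp del: of_nat_Suc)
    ultimately have "\<bar>real n * f r - real n * r * f 1\<bar> \<le> f 1"
      by (auto simp: algebra_simps abs_le_iff)
    moreover have "real n * \<bar>f r - r * f 1\<bar> = \<bar>real n * (f r - r * f 1)\<bar>"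
      by (simp add: abs_mult)
    ultimately show ?thesis by (simp add: right_diff_distrib mult.assoc)
  qed
  have "\<bar>f r - r * f 1\<bar> = 0"
  proof (rule ccontr)
    assume "\<bar>f r - r * f 1\<bar> \<noteq> 0"
    then obtain n where "real n * \<bar>f r - r * f 1\<bar> > f 1"
      using reals_Archimedean3[of "\<bar>f r - r * f 1\<bar>"] by auto
    then show False using bound[of n] by linarith
  qed
  then show ?thesis by simp
qed

text \<open>The slope is spelled out as the increment from r = 0 to r = 1, so that it is itself a
  functional of K to which the property can be applied again.\<close>

definition segment_affine :: "('a::euclidean_space set \<Rightarrow> real) \<Rightarrow> bool" where
  "segment_affine G \<longleftrightarrow> (\<forall>K v r. compact_convex K \<longrightarrow> r \<ge> 0 \<longrightarrow>
     G (K + segment (r *\<^sub>R v)) = G K + r * (G (K + segment v) - G K))"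

definition cc_mono :: "('a::euclidean_space set \<Rightarrow> real) \<Rightarrow> bool" where
  "cc_mono G \<longleftrightarrow> (\<forall>K L. compact_convex K \<longrightarrow> compact_convex L \<longrightarrow> K \<subseteq> L \<longrightarrow> G K \<le> G L)"

text \<open>By \<open>plus_segment_diff\<close> the set gained between lengths r and r + s is a
  translate of the set gained between 0 and s. The gained volume is thus additive and non-negative
  in the length, hence linear.\<close>

lemma segment_affine_volume: "segment_affine (measure lebesgue)"
  unfolding segment_affine_def
proof (intro allI impI)
  fix K :: "'a set" and v and r :: real
  assume K: "compact_convex K" and "r \<ge> 0"
  define f where "f t = measure lebesgue (K + segment (t *\<^sub>R v)) - measure lebesgue K" for t
  have lm: "K + segment w \<in> lmeasurable" "K \<in> lmeasurable" for w
    using K by (auto intro!: compact_convex_lmeasurable compact_convex_plus_segment)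
  have sub: "K \<subseteq> K + segment w" for w
    using set_plus_intro[of _ K 0 "segment w"] by fastforce
  have mono: "K + segment (p *\<^sub>R v) \<subseteq> K + segment ((p + q) *\<^sub>R v)" if pq: "p \<ge> 0" "q \<ge> 0" for p q
  proof
    fix y assume "y \<in> K + segment (p *\<^sub>R v)"
    then obtain k t where "k \<in> K" "0 \<le> t" "t \<le> p" "y = k + t *\<^sub>R v"
      using mem_plus_segment_iff[OF pq(1)] by blast
    then show "y \<in> K + segment ((p + q) *\<^sub>R v)"
      using pq mem_plus_segment_iff[of "p + q" y K v]
      by (auto intro!: bexI[of _ k] exI[of _ t])
  qed
  have "f (p + q) = f p + f q" if "p \<ge> 0" "q \<ge> 0" for p q
  proof -
    have "measure lebesgue (K + segment ((p + q) *\<^sub>R v)) - measure lebesgue (K + segment (p *\<^sub>R v))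
        = measure lebesgue ((K + segment ((p + q) *\<^sub>R v)) - (K + segment (p *\<^sub>R v)))"
      using lm mono[OF that] by (subst measurable_measure_Diff) (auto simp: fmeasurableD)
    also have "\<dots> = measure lebesgue ((K + segment (q *\<^sub>R v)) - K)"
      using that K by (subst plus_segment_diff) (auto simp: measure_translation compact_convex_def)
    also have "\<dots> = f q"
      unfolding f_def using lm sub by (subst measurable_measure_Diff) (auto simp: fmeasurableD)
    finally show ?thesis by (simp add: f_def)
  qed
  moreover have "f p \<ge> 0" for p
    unfolding f_def using measure_mono_fmeasurable[OF sub] lm fmeasurableD by fastforce
  ultimately have "f r = r * f 1"
    using \<open>r \<ge> 0\<close> additive_nonneg_imp_linear[of f r] by blast
  then show "measure lebesgue (K + segment (r *\<^sub>R v))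
     = measure lebesgue K + r * (measure lebesgue (K + segment v) - measure lebesgue K)"
    by (simp add: f_def)
qed

lemma cc_mono_volume: "cc_mono (measure lebesgue)"
  unfolding cc_mono_def using measure_mono_fmeasurable compact_convex_lmeasurable fmeasurableD
  by blast

text \<open>For G the volume in dimension n and K a convex body, this is the length of v times the
  (n-1)-volume of the projection of K along v; iterated differences are mixed volumes up to a
  factor.\<close>

definition segment_diff :: "'a::euclidean_space \<Rightarrow> ('a set \<Rightarrow> real) \<Rightarrow> 'a set \<Rightarrow> real" where
  "segment_diff v G K = G (K + segment v) - G K"

text \<open>Adding segments commutes, so this is a difference of two affine functions of r.\<close>

lemma segment_affine_segment_diff:
  assumes "segment_affine G"
  shows "segment_affine (segment_diff v G)"
  unfolding segment_affine_def
proof (intro allI impI)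
  fix K :: "'a set" and w and r :: real
  assume K: "compact_convex K" and r: "r \<ge> 0"
  have "K + segment (r *\<^sub>R w) + segment v = K + segment v + segment (r *\<^sub>R w)"
       "K + segment w + segment v = K + segment v + segment w"
    by (simp_all add: ac_simps)
  moreover have "G (K + segment v + segment (r *\<^sub>R w))
      = G (K + segment v) + r * (G (K + segment v + segment w) - G (K + segment v))"
    "G (K + segment (r *\<^sub>R w)) = G K + r * (G (K + segment w) - G K)"
    using assms K r by (auto simp: segment_affine_def compact_convex_plus_segment)
  ultimately show "segment_diff v G (K + segment (r *\<^sub>R w))
     = segment_diff v G K + r * (segment_diff v G (K + segment w) - segment_diff v G K)"
    by (simp add: segment_diff_def algebra_simps)
qed

text \<open>The difference is the slope of \<open>r \<mapsto> G (K + [0, r v])\<close>, and slopes of affine functions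
  inherit inequalities that hold for all large \<open>r\<close>.\<close>

lemma cc_mono_segment_diff:
  assumes aff: "segment_affine G" and mono: "cc_mono G"
  shows "cc_mono (segment_diff v G)"
  unfolding cc_mono_def
proof (intro allI impI)
  fix K L :: "'a set"
  assume K: "compact_convex K" and L: "compact_convex L" and KL: "K \<subseteq> L"
  define x y where "x = segment_diff v G K" and "y = segment_diff v G L"
  have le: "G K + r * x \<le> G L + r * y" if "r \<ge> 0" for r
  proof -
    have "G (K + segment (r *\<^sub>R v)) \<le> G (L + segment (r *\<^sub>R v))"
      using mono K L KL set_plus_mono_left[of K L]
      by (auto simp: cc_mono_def compact_convex_plus_segment)
    then show ?thesis
      using aff K L that by (simp add: segment_affine_def x_def y_def segment_diff_def)
  qed
  show "segment_diff v G K \<le> segment_diff v G L"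
  proof (rule ccontr)
    assume "\<not> ?thesis"
    then have "x - y > 0" by (simp add: x_def y_def)
    then obtain n where "real n * (x - y) > G L - G K"
      using reals_Archimedean3 by blast
    then show False using le[of "real n"] by (simp add: algebra_simps)
  qed
qed

section \<open>Zonotopes and their Steiner polynomials\<close>

definition zonotope :: "'a::euclidean_space list \<Rightarrow> 'a set" where
  "zonotope vs = sum_list (map segment vs)"

lemma zonotope_simps [simp]:
  "zonotope [] = {0}" "zonotope (v # vs) = segment v + zonotope vs"
  by (simp_all add: zonotope_def)

lemma compact_convex_zonotope: "compact_convex (zonotope vs)"
  by (induction vs) (auto simp: compact_convex_plus compact_convex_segment,
      simp add: compact_convex_def)

lemma scaleR_set_plus: "(*\<^sub>R) r ` (A + B) = (*\<^sub>R) r ` A + (*\<^sub>R) r ` (B :: 'a::real_vector set)"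
  by (force simp: set_plus_def scaleR_add_right image_iff)

lemma scaleR_zonotope: "(*\<^sub>R) r ` zonotope vs = zonotope (map ((*\<^sub>R) r) vs)"
proof (induction vs)
  case (Cons v vs)
  have "(*\<^sub>R) r ` segment v = segment (r *\<^sub>R v)"
    using closed_segment_linear_image[of "(*\<^sub>R) r" 0 v] by (simp add: linear_scaleR)
  then show ?case using Cons by (simp add: scaleR_set_plus)
qed simp

text \<open>Induction on the generators with \<open>G\<close> arbitrary: the hypothesis is applied
  both to \<open>G\<close> and to its slope in direction v. Coefficients are chosen before K and r,
  as functionals, so that they carry monotonicity along.\<close>

lemma segment_affine_zonotope_polynomial:
  fixes vs :: "'a::euclidean_space list" and G :: "'a set \<Rightarrow> real"
  assumes "segment_affine G" "cc_mono G" "G {} = 0"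
  shows "\<exists>c. (\<forall>j. cc_mono (c j) \<and> c j {} = 0) \<and>
     (\<forall>K r. compact_convex K \<longrightarrow> r \<ge> 0 \<longrightarrow>
        G (K + (*\<^sub>R) r ` zonotope vs) = (\<Sum>j\<le>length vs. c j K * r ^ j))"
  using assms
proof (induction vs arbitrary: G)
  case Nil
  have "(*\<^sub>R) r ` zonotope [] = {0::'a}" for r by simp
  then show ?case using Nil by (intro exI[of _ "\<lambda>_. G"]) auto
next
  case (Cons v vs)
  let ?D = "segment_diff v G" and ?n = "length vs"
  obtain c where c: "\<And>j. cc_mono (c j)" "\<And>j. c j {} = 0"
    "\<And>K r. compact_convex K \<Longrightarrow> r \<ge> 0 \<Longrightarrow>
       G (K + (*\<^sub>R) r ` zonotope vs) = (\<Sum>j\<le>?n. c j K * r ^ j)"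
    using Cons.IH[OF Cons.prems] by blast
  have "?D {} = 0" using Cons.prems by (simp add: segment_diff_def)
  then obtain d where d: "\<And>j. cc_mono (d j)" "\<And>j. d j {} = 0"
    "\<And>K r. compact_convex K \<Longrightarrow> r \<ge> 0 \<Longrightarrow>
       ?D (K + (*\<^sub>R) r ` zonotope vs) = (\<Sum>j\<le>?n. d j K * r ^ j)"
    using Cons.IH[of ?D] Cons.prems segment_affine_segment_diff cc_mono_segment_diff by blast
  \<comment> \<open>Coefficients of p + r q. The guard matters at j = \<open>Suc ?n\<close>, where
    \<open>c\<close> is unconstrained.\<close>
  define e where "e j K = (if j \<le> ?n then c j K else 0) + (case j of 0 \<Rightarrow> 0 | Suc i \<Rightarrow> d i K)"
    for j K
  have e: "cc_mono (e j)" "e j {} = 0" for j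
    using c(1,2) d(1,2) by (auto simp: cc_mono_def e_def split: nat.split intro!: add_mono)
  have "G (K + (*\<^sub>R) r ` zonotope (v # vs)) = (\<Sum>j\<le>length (v # vs). e j K * r ^ j)"
    if K: "compact_convex K" and r: "r \<ge> 0" for K r
  proof -
    let ?L = "K + (*\<^sub>R) r ` zonotope vs"
    have L: "compact_convex ?L"
      unfolding scaleR_zonotope by (rule compact_convex_plus[OF K compact_convex_zonotope])
    have "K + (*\<^sub>R) r ` zonotope (v # vs) = ?L + segment (r *\<^sub>R v)"
      unfolding scaleR_zonotope by (simp add: ac_simps)
    then have "G (K + (*\<^sub>R) r ` zonotope (v # vs)) = G ?L + r * ?D ?L"
      using Cons.prems(1) L r by (simp add: segment_affine_def segment_diff_def)
    also have "\<dots> = (\<Sum>j\<le>?n. c j K * r ^ j) + (\<Sum>j\<le>?n. d j K * r ^ Suc j)"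
      using c(3)[OF K r] d(3)[OF K r] by (simp add: sum_distrib_left algebra_simps)
    also have "(\<Sum>j\<le>?n. c j K * r ^ j) = (\<Sum>j\<le>Suc ?n. (if j \<le> ?n then c j K else 0) * r ^ j)"
      by simp
    also have "(\<Sum>j\<le>?n. d j K * r ^ Suc j)
        = (\<Sum>j\<le>Suc ?n. (case j of 0 \<Rightarrow> 0 | Suc i \<Rightarrow> d i K) * r ^ j)"
      by (simp add: sum.atMost_Suc_shift del: sum.atMost_Suc)
    also have "(\<Sum>j\<le>Suc ?n. (if j \<le> ?n then c j K else 0) * r ^ j) + \<dots>
        = (\<Sum>j\<le>Suc ?n. e j K * r ^ j)"
      unfolding sum.distrib[symmetric] e_def by (simp add: algebra_simps)
    finally show ?thesis by simp
  qed
  then show ?case using e by blast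
qed

section \<open>Approximating the ball by zonotopes\<close>

text \<open>The support function of \<open>zonotope vs\<close>: a segment from 0 to v contributes
  max 0 (a \<bullet> v), and support functions add under Minkowski sums.\<close>

abbreviation zonotope_support :: "'a::euclidean_space list \<Rightarrow> 'a \<Rightarrow> real" where
  "zonotope_support vs a \<equiv> (\<Sum>v\<leftarrow>vs. max 0 (a \<bullet> v))"

lemma inner_le_zonotope_support:
  assumes "x \<in> zonotope vs"
  shows "a \<bullet> x \<le> zonotope_support vs a"
  using assms
proof (induction vs arbitrary: x)
  case (Cons v vs)
  then obtain y z where yz: "x = y + z" "y \<in> segment v" "z \<in> zonotope vs"
    by (auto elim: set_plus_elim)
  obtain t where "0 \<le> t" "t \<le> 1" "y = t *\<^sub>R v"
    using yz(2) by (auto simp: closed_segment_def)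
  then have "a \<bullet> y \<le> max 0 (a \<bullet> v)"
    by (cases "a \<bullet> v \<ge> 0") (auto simp: mult_left_le_one_le mult_nonneg_nonpos max_def)
  then show ?case
    using Cons.IH[OF yz(3)] by (simp add: yz(1) inner_add_right)
qed simp

lemma zonotope_support_attained: "\<exists>x\<in>zonotope vs. a \<bullet> x = zonotope_support vs a"
proof (induction vs)
  case (Cons v vs)
  then obtain z where z: "z \<in> zonotope vs" "a \<bullet> z = zonotope_support vs a" by blast
  define y where "y = (if a \<bullet> v \<ge> 0 then v else 0)"
  have "y + z \<in> segment v + zonotope vs"
    using z by (intro set_plus_intro) (auto simp: y_def)
  moreover have "a \<bullet> (y + z) = zonotope_support (v # vs) a"
    using z by (simp add: y_def inner_add_right)
  ultimately show ?case by (metis zonotope_simps(2))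
qed simp

lemma cball_subset_zonotope:
  assumes "\<And>a. norm a \<le> zonotope_support vs a"
  shows "cball 0 1 \<subseteq> zonotope vs"
proof
  fix y :: 'a assume y: "y \<in> cball 0 1"
  show "y \<in> zonotope vs"
  proof (rule ccontr)
    assume "y \<notin> zonotope vs"
    then obtain a b where ab: "a \<bullet> y < b" "\<And>x. x \<in> zonotope vs \<Longrightarrow> a \<bullet> x > b"
      using separating_hyperplane_closed_point[of "zonotope vs" y] compact_convex_zonotope[of vs]
      by (auto simp: compact_convex_def compact_imp_closed)
    \<comment> \<open>The zonotope is on the upper side of the separating hyperplane, so its extent
      is measured in direction -a.\<close>
    obtain x where x: "x \<in> zonotope vs" "(- a) \<bullet> x = zonotope_support vs (- a)"
      using zonotope_support_attained by blast
    have "norm a \<le> (- a) \<bullet> x"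
      using assms[of "- a"] x(2) by simp
    moreover have "(- a) \<bullet> y \<le> norm a"
      using norm_cauchy_schwarz[of "- a" y] y mult_left_le[of "norm y" "norm a"] by simp
    ultimately show False using ab(1) ab(2)[OF x(1)] by simp
  qed
qed

text \<open>The support bound is tested in the direction of the point y itself.\<close>

lemma zonotope_subset_cball:
  assumes "\<And>a. zonotope_support vs a \<le> r * norm a" and "r \<ge> 0"
  shows "zonotope vs \<subseteq> cball 0 r"
proof
  fix y assume "y \<in> zonotope vs"
  then have "y \<bullet> y \<le> r * norm y"
    using inner_le_zonotope_support assms(1) order.trans by blast
  then have "norm y * norm y \<le> r * norm y"
    by (simp add: power2_norm_eq_inner flip: power2_eq_square)
  then show "y \<in> cball 0 r"
    using assms(2) by (cases "y = 0") (auto simp: mult_le_cancel_right)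
qed

text \<open>The constant \<open>c\<close> below is the integral of \<open>max 0 (e \<bullet> v)\<close> over the unit ball for a unit vector
  \<open>e\<close>; it does not depend on \<open>e\<close> by rotation invariance. Replacing the identity map on the ball by
  a simple function that is close in \<open>L\<^sup>1\<close> turns the integral into the support function of a
  zonotope.\<close>

lemma zonotope_support_approx_norm:
  "\<exists>c>0. \<forall>\<epsilon>>0. \<exists>vs. \<forall>a::real^'n. \<bar>zonotope_support vs a - c * norm a\<bar> \<le> \<epsilon> * norm a"
proof -
  \<comment> \<open>The cut-off makes the identity integrable and still commutes with orthogonal
    maps.\<close>
  define f :: "real^'n \<Rightarrow> real^'n" where "f v = indicator (cball 0 1) v *\<^sub>R v" for v
  define \<phi> where "\<phi> a = (\<integral>v. max 0 (a \<bullet> f v) \<partial>lborel)" for a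
  have f_int: "integrable lborel f"
    unfolding f_def using borel_integrable_compact[of "cball (0::real^'n) 1" "\<lambda>v. v"] by simp
  have int: "integrable lborel (\<lambda>v. max 0 (a \<bullet> f v))" for a
    using f_int by simp
  define e :: "real^'n" where "e = axis undefined 1"
  have e: "norm e = 1" by (simp add: e_def)
  have \<phi>: "\<phi> a = \<phi> e * norm a" for a
  proof -
    obtain T where T: "orthogonal_transformation T" "T (norm a *\<^sub>R e) = a"
      using orthogonal_transformation_exists[of "norm a *\<^sub>R e" a] e by auto
    have Tm [measurable]: "T \<in> borel_measurable borel"
      using T(1) orthogonal_transformation_linear linear_continuous_on
        borel_measurable_continuous_onI linear_conv_bounded_linear by blast
    have [measurable]: "f \<in> borel_measurable borel"
      using f_int borel_measurable_integrable by simp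
    have fT: "f (T v) = T (f v)" for v
      using T(1) by (auto simp: f_def orthogonal_transformation_norm indicator_def
          linear_0 orthogonal_transformation_linear)
    have "\<phi> a = (\<integral>v. max 0 (a \<bullet> f v) \<partial>distr lborel borel T)"
      by (simp add: \<phi>_def lborel_distr_orthogonal[OF T(1)])
    also have "\<dots> = (\<integral>v. max 0 (a \<bullet> f (T v)) \<partial>lborel)"
      by (rule integral_distr) auto
    also have "\<dots> = (\<integral>v. norm a * max 0 (e \<bullet> f v) \<partial>lborel)"
    proof (rule Bochner_Integration.integral_cong[OF refl])
      fix v
      have "a \<bullet> f (T v) = T (norm a *\<^sub>R e) \<bullet> T (f v)"
        by (simp add: fT T(2))
      also have "\<dots> = norm a * (e \<bullet> f v)"
        using T(1) by (simp add: orthogonal_transformation_def)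
      finally show "max 0 (a \<bullet> f (T v)) = norm a * max 0 (e \<bullet> f v)"
        by (simp add: max_mult_distrib_left)
    qed
    finally show ?thesis by (simp add: \<phi>_def)
  qed
  have "\<phi> e > 0"
  proof -
    \<comment> \<open>Here norm v < 3/4, so f v = v, and e \<bullet> v > 1/2 - 1/4 = 1/4.\<close>
    let ?B = "ball (e /\<^sub>R 2) (1/4)"
    have "(1/4) * measure lborel ?B = (\<integral>v. (1/4) * indicator ?B v \<partial>lborel)"
      by simp
    also have "\<dots> \<le> \<phi> e"
      unfolding \<phi>_def
    proof (rule integral_mono[OF _ int])
      show "integrable lborel (\<lambda>v. (1/4) * indicator ?B v :: real)"
        using emeasure_bounded_finite[OF bounded_ball, of "e /\<^sub>R 2" "1/4"]
        by (intro integrable_mult_right integrable_real_indicator) auto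
      fix v :: "real^'n"
      show "(1/4) * indicator ?B v \<le> max 0 (e \<bullet> f v)"
      proof (cases "v \<in> ?B")
        case True
        then have d: "norm (e /\<^sub>R 2 - v) < 1/4" by (simp add: dist_norm)
        have "norm v \<le> norm (e /\<^sub>R 2) + norm (v - e /\<^sub>R 2)"
          by (rule norm_triangle_sub)
        then have "f v = v"
          using d e by (simp add: f_def norm_minus_commute)
        moreover have "e \<bullet> (e /\<^sub>R 2 - v) \<le> norm e * norm (e /\<^sub>R 2 - v)"
          by (rule norm_cauchy_schwarz)
        moreover have "e \<bullet> e = 1" using e by (simp add: norm_eq_1)
        ultimately show ?thesis
          using True d e by (simp add: inner_diff_right)
      qed simp
    qed
    finally show ?thesis
      using content_ball_gt_0_iff[of "e /\<^sub>R 2" "1/4"] by linarith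
  qed
  moreover have "\<exists>vs. \<forall>a::real^'n. \<bar>zonotope_support vs a - \<phi> e * norm a\<bar> \<le> \<epsilon> * norm a"
    if \<epsilon>: "\<epsilon> > 0" for \<epsilon>
  proof -
    obtain S where S: "\<And>i. Bochner_Integration.simple_bochner_integrable lborel (S i)"
      and lim: "(\<lambda>i::nat. \<integral>\<^sup>+v. norm (f v - S i v) \<partial>lborel) \<longlonglongrightarrow> 0"
      using f_int unfolding integrable.simps has_bochner_integral.simps by blast
    obtain i where i: "(\<integral>\<^sup>+v. norm (f v - S i v) \<partial>lborel) < ennreal \<epsilon>"
      using order_tendstoD(2)[OF lim, of "ennreal \<epsilon>"] \<epsilon>
      by (auto simp: eventually_sequentially)
    define s where "s = S i"
    have s: "Bochner_Integration.simple_bochner_integrable lborel s" and s_int: "integrable lborel s"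
      using S by (auto simp: s_def intro: integrableI_simple_bochner_integrable)
    have fin: "finite (range s)" and simp: "simple_function lborel s"
      using s by (auto elim!: simple_bochner_integrable.cases simp: simple_function_def)
    \<comment> \<open>The level set of y = 0 has infinite measure, where \<open>measure\<close>
      returns 0; the generator is 0 in any case.\<close>
    define m where "m y = measure lborel {v. s v = y}" for y
    obtain ys where ys: "set ys = range s" "distinct ys"
      using finite_distinct_list[OF fin] by blast
    have "\<bar>zonotope_support (map (\<lambda>y. m y *\<^sub>R y) ys) a - \<phi> e * norm a\<bar> \<le> \<epsilon> * norm a" for a
    proof -
      have gs: "Bochner_Integration.simple_bochner_integrable lborel (\<lambda>v. max 0 (a \<bullet> s v))"
        using simple_bochner_integrable_compose2[of "\<lambda>x y. max 0 (a \<bullet> x)", OF _ s s] by simp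
      have "zonotope_support (map (\<lambda>y. m y *\<^sub>R y) ys) a = (\<Sum>y\<leftarrow>ys. m y * max 0 (a \<bullet> y))"
        by (simp add: comp_def m_def max_mult_distrib_left)
      also have "\<dots> = (\<Sum>y\<in>range s. m y * max 0 (a \<bullet> y))"
        using ys by (metis sum_list_distinct_conv_sum_set)
      also have "\<dots> = Bochner_Integration.simple_bochner_integral lborel (\<lambda>v. max 0 (a \<bullet> s v))"
        using simple_bochner_integral_partition[OF gs simp, of "\<lambda>y. max 0 (a \<bullet> y)"]
        by (simp add: m_def)
      also have "\<dots> = (\<integral>v. max 0 (a \<bullet> s v) \<partial>lborel)"
        by (rule simple_bochner_integrable_eq_integral[OF gs])
      finally have "zonotope_support (map (\<lambda>y. m y *\<^sub>R y) ys) a - \<phi> a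
          = (\<integral>v. max 0 (a \<bullet> s v) - max 0 (a \<bullet> f v) \<partial>lborel)"
        unfolding \<phi>_def using int integrableI_simple_bochner_integrable[OF gs]
        by (subst Bochner_Integration.integral_diff) auto
      \<comment> \<open>Since max 0 is 1-Lipschitz, one approximation in L^1 serves all directions
        a, with an error proportional to norm a.\<close>
      also have "\<bar>\<dots>\<bar> \<le> (\<integral>v. norm a * norm (f v - s v) \<partial>lborel)"
      proof (rule order.trans[OF integral_abs_bound], rule integral_mono)
        fix v
        have "\<bar>a \<bullet> s v - a \<bullet> f v\<bar> \<le> norm a * norm (f v - s v)"
          using Cauchy_Schwarz_ineq2[of a "f v - s v"] by (simp add: inner_diff_right abs_minus_commute)
        then show "\<bar>max 0 (a \<bullet> s v) - max 0 (a \<bullet> f v)\<bar> \<le> norm a * norm (f v - s v)"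
          by (simp add: max_def abs_if split: if_splits)
      qed (use f_int s_int in auto)
      also have "\<dots> = norm a * (\<integral>v. norm (f v - s v) \<partial>lborel)" by simp
      also have "\<dots> \<le> norm a * \<epsilon>"
      proof (rule mult_left_mono)
        have "ennreal (\<integral>v. norm (f v - s v) \<partial>lborel) < ennreal \<epsilon>"
          using i f_int s_int by (subst nn_integral_eq_integral[symmetric]) (auto simp: s_def)
        then show "(\<integral>v. norm (f v - s v) \<partial>lborel) \<le> \<epsilon>"
          by (simp add: ennreal_less_iff)
      qed simp
      finally show ?thesis by (simp add: \<phi>[of a] mult.commute)
    qed
    then show ?thesis by blast
  qed
  ultimately show ?thesis by blast
qed

lemma zonotope_approx_ball:
  assumes "\<epsilon> > 0"
  shows "\<exists>vs. cball 0 1 \<subseteq> zonotope vs \<and> zonotope vs \<subseteq> cball (0::real^'n) (1 + \<epsilon>)"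
proof -
  obtain c where c: "c > 0" and
    approx: "\<And>\<epsilon>. \<epsilon> > 0 \<Longrightarrow> \<exists>vs. \<forall>a::real^'n. \<bar>zonotope_support vs a - c * norm a\<bar> \<le> \<epsilon> * norm a"
    using zonotope_support_approx_norm by blast
  \<comment> \<open>Solves (c + \<delta>) / (c - \<delta>) = 1 + \<epsilon>; dividing the generators
    by c - \<delta> then makes the lower support bound exactly 1.\<close>
  define \<delta> where "\<delta> = c * \<epsilon> / (2 + \<epsilon>)"
  have \<delta>: "\<delta> > 0" "c - \<delta> > 0" "c + \<delta> = (1 + \<epsilon>) * (c - \<delta>)"
    using c assms by (auto simp: \<delta>_def field_simps)
  obtain vs where vs: "\<And>a::real^'n. \<bar>zonotope_support vs a - c * norm a\<bar> \<le> \<delta> * norm a"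
    using approx[OF \<delta>(1)] by blast
  define ws where "ws = map (\<lambda>v. v /\<^sub>R (c - \<delta>)) vs"
  have supp: "zonotope_support ws a = zonotope_support vs a / (c - \<delta>)" for a
  proof -
    have "max 0 (a \<bullet> (v /\<^sub>R (c - \<delta>))) = max 0 (a \<bullet> v) / (c - \<delta>)" for v
      using \<delta>(2) by (simp add: max_def divide_inverse mult.commute zero_le_mult_iff)
    then show ?thesis
      unfolding ws_def by (induction vs) (simp_all add: add_divide_distrib)
  qed
  have "norm a \<le> zonotope_support ws a" "zonotope_support ws a \<le> (1 + \<epsilon>) * norm a" for a
  proof -
    have "(c - \<delta>) * norm a \<le> zonotope_support vs a" "zonotope_support vs a \<le> (c + \<delta>) * norm a"
      using vs[of a] by (auto simp: abs_le_iff algebra_simps)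
    note this(1) this(2)[unfolded \<delta>(3)]
    then show "norm a \<le> zonotope_support ws a" "zonotope_support ws a \<le> (1 + \<epsilon>) * norm a"
      using \<delta>(2) by (auto simp: supp pos_le_divide_eq pos_divide_le_eq mult_ac)
  qed
  then show ?thesis
    using cball_subset_zonotope[of ws] zonotope_subset_cball[of ws "1 + \<epsilon>"] assms by auto
qed

section \<open>The Steiner formula\<close>

text \<open>Passing from p(r) to p(2r) - 2^(n+1) p(r) kills the top coefficient and multiplies the
  j-th by 2^j - 2^(n+1), which is nonzero for j \<le> n.\<close>

lemma polynomial_coeffs_convergent:
  fixes c :: "nat \<Rightarrow> nat \<Rightarrow> real"
  assumes "\<And>r. r > 0 \<Longrightarrow> convergent (\<lambda>N. \<Sum>j\<le>n. c N j * r ^ j)" and "j \<le> n"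
  shows "convergent (\<lambda>N. c N j)"
  using assms
proof (induction n arbitrary: c j)
  case 0
  show ?case using "0.prems"(1)[of 1] "0.prems"(2) by simp
next
  case (Suc n)
  define d where "d N j = c N j * (2 ^ j - 2 ^ Suc n)" for N j
  have d: "convergent (\<lambda>N. \<Sum>j\<le>n. d N j * r ^ j)" if r: "r > 0" for r
  proof -
    have "(\<Sum>j\<le>n. d N j * r ^ j)
        = (\<Sum>j\<le>Suc n. c N j * (2 * r) ^ j) - 2 ^ Suc n * (\<Sum>j\<le>Suc n. c N j * r ^ j)" for N
      by (simp add: d_def sum_distrib_left sum_subtractf[symmetric] power_mult_distrib algebra_simps)
    moreover have "convergent (\<lambda>N. (\<Sum>j\<le>Suc n. c N j * (2 * r) ^ j)
        - 2 ^ Suc n * (\<Sum>j\<le>Suc n. c N j * r ^ j))"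
      using Suc.prems(1)[of "2 * r"] Suc.prems(1)[of r] r
      by (intro convergent_diff convergent_mult convergent_const) (auto simp del: sum.atMost_Suc power_Suc)
    ultimately show ?thesis by simp
  qed
  have low: "convergent (\<lambda>N. c N i)" if "i \<le> n" for i
  proof -
    have "(2::real) ^ i - 2 ^ Suc n \<noteq> 0"
      using that power_inject_exp[of "2::real" i "Suc n"] by (auto simp del: power_Suc)
    then have "c N i = d N i * inverse (2 ^ i - 2 ^ Suc n)" for N
      unfolding d_def by (simp del: power_Suc)
    moreover have "convergent (\<lambda>N. d N i * inverse (2 ^ i - 2 ^ Suc n))"
      by (intro convergent_mult convergent_const Suc.IH[OF d that])
    ultimately show ?thesis by (simp del: power_Suc)
  qed
  show ?case
  proof (cases "j = Suc n")
    case True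
    have "convergent (\<lambda>N. \<Sum>j\<le>Suc n. c N j)"
      using Suc.prems(1)[of 1] by (simp del: sum.atMost_Suc)
    moreover have "convergent (\<lambda>N. \<Sum>j\<le>n. c N j)"
      using low by (intro convergent_sum) auto
    ultimately have "convergent (\<lambda>N. (\<Sum>j\<le>Suc n. c N j) - (\<Sum>j\<le>n. c N j))"
      by (rule convergent_diff)
    then show ?thesis using True by simp
  qed (use Suc.prems(2) low in auto)
qed

section \<open>Parallel bodies and the passage from zonotopes to the ball\<close>

abbreviation parallel_body :: "'a::euclidean_space set \<Rightarrow> real \<Rightarrow> 'a set" where
  "parallel_body K r \<equiv> (\<Union>x\<in>K. cball x r)"

lemma parallel_body_eq_plus: "parallel_body K r = K + cball 0 r"
proof (intro equalityI subsetI)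
  fix y assume "y \<in> parallel_body K r"
  then obtain x where "x \<in> K" "norm (y - x) \<le> r"
    by (auto simp: dist_norm norm_minus_commute)
  then show "y \<in> K + cball 0 r"
    using set_plus_intro[of x K "y - x" "cball 0 r"] by simp
next
  fix y assume "y \<in> K + cball 0 r"
  then show "y \<in> parallel_body K r"
    by (elim set_plus_elim) (auto simp: dist_norm intro!: bexI)
qed

lemma compact_convex_parallel_body: "compact_convex K \<Longrightarrow> compact_convex (parallel_body K r)"
  unfolding parallel_body_eq_plus by (intro compact_convex_plus) (auto simp: compact_convex_def)

text \<open>Scaling by 0 keeps an empty ball empty, whereas \<open>cball 0 0\<close> is a point;
  hence the case split.\<close>

lemma scaleR_cball_unit:
  assumes "r \<ge> 0"
  shows "(*\<^sub>R) r ` cball (0::'a::euclidean_space) s = (if r = 0 \<and> s < 0 then {} else cball 0 (r * s))"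
proof (cases "r = 0")
  case True
  then show ?thesis by (cases "s < 0") (auto simp: image_constant_conv)
next
  case False
  then show ?thesis using cball_scale[of r 0 s] assms by simp
qed

text \<open>Continuity from above. As K is closed, distances to K are attained, so the larger bodies
  intersect in exactly the one of radius r. The radii are those of the balls around the
  approximating zonotopes.\<close>

lemma parallel_body_decreasing_limit:
  fixes K :: "'a::euclidean_space set"
  assumes K: "compact_convex K" and r: "r \<ge> 0"
  shows "(\<lambda>N. measure lebesgue (parallel_body K (r * (1 + 1 / real (Suc N)))))
           \<longlonglongrightarrow> measure lebesgue (parallel_body K r)"
proof -
  define \<rho> where "\<rho> N = r * (1 + 1 / real (Suc N))" for N
  have \<rho>: "decseq \<rho>" "\<rho> \<longlonglongrightarrow> r"
  proof -
    show "decseq \<rho>"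
      unfolding decseq_def \<rho>_def using r
      by (auto intro!: mult_left_mono divide_left_mono simp del: of_nat_Suc)
    have "\<rho> \<longlonglongrightarrow> r * (1 + 0)"
      unfolding \<rho>_def by (intro tendsto_intros LIMSEQ_Suc[OF lim_1_over_n])
    then show "\<rho> \<longlonglongrightarrow> r" by simp
  qed
  have "(\<Inter>N. parallel_body K (\<rho> N)) = parallel_body K r"
  proof (intro equalityI subsetI)
    fix y assume y: "y \<in> (\<Inter>N. parallel_body K (\<rho> N))"
    then have "K \<noteq> {}" by auto
    have "infdist y K \<le> \<rho> N" for N
    proof -
      obtain x where "x \<in> K" "dist x y \<le> \<rho> N" using y by auto
      then show ?thesis using infdist_le[of x K y] by (simp add: dist_commute)
    qed
    then have "infdist y K \<le> r"
      by (intro LIMSEQ_le_const[OF \<rho>(2)]) auto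
    moreover obtain x where "x \<in> K" "infdist y K = dist y x"
      using infdist_attains_inf[of K y] K \<open>K \<noteq> {}\<close>
      by (auto simp: compact_convex_def compact_imp_closed)
    ultimately show "y \<in> parallel_body K r"
      by (auto simp: dist_commute)
  next
    fix y assume "y \<in> parallel_body K r"
    moreover have "r \<le> \<rho> N" for N
      using \<rho> decseq_ge by blast
    ultimately show "y \<in> (\<Inter>N. parallel_body K (\<rho> N))"
      by (auto intro: order.trans)
  qed
  moreover have "(\<lambda>N. measure lebesgue (parallel_body K (\<rho> N)))
      \<longlonglongrightarrow> measure lebesgue (\<Inter>N. parallel_body K (\<rho> N))"
  proof (rule Lim_measure_decseq)
    have lm: "parallel_body K t \<in> lmeasurable" for t
      by (rule compact_convex_lmeasurable[OF compact_convex_parallel_body[OF K]])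
    show "range (\<lambda>N. parallel_body K (\<rho> N)) \<subseteq> sets lebesgue"
      using lm by (auto simp: fmeasurableD)
    show "emeasure lebesgue (parallel_body K (\<rho> N)) \<noteq> \<infinity>" for N
      using lm fmeasurableD2 infinity_ennreal_def by metis
    show "decseq (\<lambda>N. parallel_body K (\<rho> N))"
      using \<rho>(1) unfolding decseq_def by (intro allI impI UN_mono subset_cball) auto
  qed
  ultimately show ?thesis by (simp add: \<rho>_def)
qed

text \<open>By non-negativity a single term is at most the sum, so c_j r^(n+1) \<le> C r^n for all r
  \<ge> 1.\<close>

lemma nonneg_coeff_eq_0_of_growth:
  fixes c :: "nat \<Rightarrow> real"
  assumes nonneg: "\<And>j. j \<le> m \<Longrightarrow> c j \<ge> 0"
    and bound: "\<And>r. r \<ge> 1 \<Longrightarrow> (\<Sum>j\<le>m. c j * r ^ j) \<le> C * r ^ n"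
    and "j \<le> m" "j > n"
  shows "c j = 0"
proof (rule ccontr)
  assume "c j \<noteq> 0"
  then have pos: "c j > 0" using nonneg \<open>j \<le> m\<close> by force
  obtain q where q: "real q * c j > max C 0"
    using reals_Archimedean3[OF pos] by blast
  define r where "r = max 1 (real q)"
  have r: "r \<ge> 1" by (simp add: r_def)
  have "c j * r * r ^ n = c j * r ^ Suc n" by simp
  also have "\<dots> \<le> c j * r ^ j"
    using pos r \<open>j > n\<close> by (intro mult_left_mono power_increasing) auto
  also have "\<dots> \<le> (\<Sum>j\<le>m. c j * r ^ j)"
    using nonneg r \<open>j \<le> m\<close> by (intro member_le_sum) auto
  also have "\<dots> \<le> C * r ^ n" by (rule bound[OF r])
  finally have "c j * r \<le> C" using r by simp
  moreover have "real q * c j \<le> c j * r"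
    using pos by (simp add: r_def mult.commute)
  ultimately show False using q by linarith
qed

theorem steiner_formula:
  "\<exists>V :: (real^'n) set \<Rightarrow> nat \<Rightarrow> real. \<forall>K. compact_convex K \<longrightarrow> steiner_coeffs K (V K) \<and>
     (\<forall>L j. compact_convex L \<longrightarrow> K \<subseteq> L \<longrightarrow> V K j \<le> V L j)"
proof -
  let ?n = "CARD('n)"
  define vol :: "(real^'n) set \<Rightarrow> real" where "vol = measure lebesgue"
  have "\<forall>N. \<exists>vs. cball 0 1 \<subseteq> zonotope vs \<and> zonotope vs \<subseteq> cball (0::real^'n) (1 + 1 / real (Suc N))"
    by (intro allI zonotope_approx_ball) simp
  then obtain vs :: "nat \<Rightarrow> (real^'n) list" where vs: "\<And>N. cball 0 1 \<subseteq> zonotope (vs N)"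
    "\<And>N. zonotope (vs N) \<subseteq> cball 0 (1 + 1 / real (Suc N))"
    by metis
  define Z where "Z N = zonotope (vs N)" for N
  have "\<forall>N. \<exists>c. (\<forall>j. cc_mono (c j) \<and> c j {} = 0) \<and>
     (\<forall>K r. compact_convex K \<longrightarrow> r \<ge> 0 \<longrightarrow>
        vol (K + (*\<^sub>R) r ` Z N) = (\<Sum>j\<le>length (vs N). c j K * r ^ j))"
    unfolding vol_def Z_def
    by (intro allI segment_affine_zonotope_polynomial segment_affine_volume cc_mono_volume) simp
  then obtain c where c: "\<And>N j. cc_mono (c N j)" "\<And>N j. c N j {} = 0"
    "\<And>N K r. compact_convex K \<Longrightarrow> r \<ge> 0 \<Longrightarrow>
        vol (K + (*\<^sub>R) r ` Z N) = (\<Sum>j\<le>length (vs N). c N j K * r ^ j)"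
    by metis
  have c_nonneg: "c N j K \<ge> 0" if "compact_convex K" for N j K
  proof -
    have "c N j {} \<le> c N j K"
      using c(1)[of N j] that by (auto simp: cc_mono_def compact_convex_def)
    then show ?thesis by (simp add: c(2))
  qed
  have sandwich: "parallel_body K r \<subseteq> K + (*\<^sub>R) r ` Z N"
    "K + (*\<^sub>R) r ` Z N \<subseteq> parallel_body K (r * (1 + 1 / real (Suc N)))"
    if "r \<ge> 0" for K r N
  proof -
    have "(*\<^sub>R) r ` cball 0 1 \<subseteq> (*\<^sub>R) r ` Z N"
      "(*\<^sub>R) r ` Z N \<subseteq> (*\<^sub>R) r ` cball 0 (1 + 1 / real (Suc N))"
      using vs[of N] by (auto simp: Z_def)
    moreover have "\<not> 1 + 1 / real (Suc N) < 0" by (simp add: add_nonneg_nonneg not_less)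
    ultimately have "cball 0 r \<subseteq> (*\<^sub>R) r ` Z N"
      "(*\<^sub>R) r ` Z N \<subseteq> cball 0 (r * (1 + 1 / real (Suc N)))"
      using that by (simp_all add: scaleR_cball_unit)
    then show "parallel_body K r \<subseteq> K + (*\<^sub>R) r ` Z N"
      "K + (*\<^sub>R) r ` Z N \<subseteq> parallel_body K (r * (1 + 1 / real (Suc N)))"
      unfolding parallel_body_eq_plus by - (rule set_plus_mono2[OF order.refl], assumption)+
  qed
  have cc_sum: "compact_convex (K + (*\<^sub>R) r ` Z N)" if "compact_convex K" for K r N
    unfolding Z_def scaleR_zonotope by (intro compact_convex_plus that compact_convex_zonotope)
  have vol_mono: "vol A \<le> vol B" if "A \<subseteq> B" "compact_convex A" "compact_convex B" for A B
    using cc_mono_volume that by (auto simp: vol_def cc_mono_def)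
  \<comment> \<open>However many generators there are, for r \<ge> 1 the body lies in a ball of
    radius R + 2r \<le> (R + 2) r, so its volume has order r^n.\<close>
  have high: "c N j K = 0" if K: "compact_convex K" and j: "j \<le> length (vs N)" "j > ?n" for N j K
  proof -
    obtain R where R: "R > 0" "K \<subseteq> cball 0 R"
      using K compact_imp_bounded[of K] unfolding bounded_pos compact_convex_def by (auto simp: subset_iff)
    have "vol (K + (*\<^sub>R) r ` Z N) \<le> unit_ball_vol (real ?n) * (R + 2) ^ ?n * r ^ ?n"
      if r: "r \<ge> 1" for r
    proof -
      have "K + (*\<^sub>R) r ` Z N \<subseteq> parallel_body K (r * (1 + 1 / real (Suc N)))"
        using sandwich(2) r by simp
      also have "\<dots> \<subseteq> cball 0 ((R + 2) * r)"
      proof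
        fix y assume "y \<in> parallel_body K (r * (1 + 1 / real (Suc N)))"
        then obtain x where x: "norm x \<le> R" "norm (y - x) \<le> r * (1 + 1 / real (Suc N))"
          using R(2) by (auto simp: dist_norm norm_minus_commute)
        have "r * (1 + 1 / real (Suc N)) \<le> r * 2"
          using r by (intro mult_left_mono) auto
        moreover have "R \<le> R * r" using R r by simp
        moreover have "norm y \<le> norm x + norm (y - x)" by (rule norm_triangle_sub)
        ultimately show "y \<in> cball 0 ((R + 2) * r)" using x by (simp add: algebra_simps)
      qed
      finally have "vol (K + (*\<^sub>R) r ` Z N) \<le> vol (cball 0 ((R + 2) * r))"
        by (intro vol_mono cc_sum K) (auto simp: compact_convex_def)
      also have "\<dots> = unit_ball_vol (real ?n) * ((R + 2) * r) ^ ?n"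
        using R r by (simp add: vol_def content_cball)
      finally show ?thesis by (simp only: power_mult_distrib mult.assoc)
    qed
    then show ?thesis
      using c(3)[OF K] c_nonneg[OF K] j
      by (intro nonneg_coeff_eq_0_of_growth[where c = "\<lambda>j. c N j K" and n = ?n and m = "length (vs N)"])
         auto
  qed
  \<comment> \<open>Padding by 0 gives all N the common formal degree \<open>?n\<close>, even if
    there are fewer generators.\<close>
  define d where "d N j K = (if j \<le> length (vs N) then c N j K else 0)" for N j K
  have d_mono: "d N j K \<le> d N j L" if "compact_convex K" "compact_convex L" "K \<subseteq> L" for N j K L
    using c(1) that by (auto simp: d_def cc_mono_def)
  have d: "vol (K + (*\<^sub>R) r ` Z N) = (\<Sum>j\<le>?n. d N j K * r ^ j)"
    if K: "compact_convex K" and r: "r \<ge> 0" for K r N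
  proof -
    have "(\<Sum>j\<le>length (vs N). c N j K * r ^ j) = (\<Sum>j\<le>length (vs N) + ?n. d N j K * r ^ j)"
      by (rule sum.mono_neutral_cong_left) (auto simp: d_def)
    also have "\<dots> = (\<Sum>j\<le>?n. d N j K * r ^ j)"
      using high[OF K] by (intro sum.mono_neutral_cong_right) (auto simp: d_def not_le)
    finally show ?thesis using c(3)[OF K r] by simp
  qed
  have lim: "(\<lambda>N. \<Sum>j\<le>?n. d N j K * r ^ j) \<longlonglongrightarrow> vol (parallel_body K r)"
    if K: "compact_convex K" and r: "r \<ge> 0" for K r
  proof -
    note cc = cc_sum[OF K] compact_convex_parallel_body[OF K]
    have "(\<lambda>N. vol (K + (*\<^sub>R) r ` Z N)) \<longlonglongrightarrow> vol (parallel_body K r)"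
    proof (rule tendsto_sandwich)
      show "\<forall>\<^sub>F N in sequentially. vol (parallel_body K r) \<le> vol (K + (*\<^sub>R) r ` Z N)"
        "\<forall>\<^sub>F N in sequentially. vol (K + (*\<^sub>R) r ` Z N)
            \<le> vol (parallel_body K (r * (1 + 1 / real (Suc N))))"
        using sandwich[OF r] by (intro always_eventually allI vol_mono cc; blast)+
      show "(\<lambda>N. vol (parallel_body K (r * (1 + 1 / real (Suc N))))) \<longlonglongrightarrow> vol (parallel_body K r)"
        unfolding vol_def by (rule parallel_body_decreasing_limit[OF K r])
    qed simp
    then show ?thesis by (simp add: d[OF K r])
  qed
  define a where "a j K = lim (\<lambda>N. d N j K)" for j K
  have a: "(\<lambda>N. d N j K) \<longlonglongrightarrow> a j K" if "compact_convex K" "j \<le> ?n" for j K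
  proof -
    have "convergent (\<lambda>N. \<Sum>j\<le>?n. d N j K * r ^ j)" if "r > 0" for r
      using lim[OF \<open>compact_convex K\<close>, of r] that by (auto simp: convergent_def)
    then have "convergent (\<lambda>N. d N j K)"
      using polynomial_coeffs_convergent[where n = ?n and c = "\<lambda>N j. d N j K"] that by blast
    then show ?thesis by (simp add: a_def convergent_LIMSEQ_iff)
  qed
  have vol_eq: "vol (parallel_body K r) = (\<Sum>j\<le>?n. a j K * r ^ j)"
    if K: "compact_convex K" and r: "r \<ge> 0" for K r
  proof (rule LIMSEQ_unique[OF lim[OF K r]])
    show "(\<lambda>N. \<Sum>j\<le>?n. d N j K * r ^ j) \<longlonglongrightarrow> (\<Sum>j\<le>?n. a j K * r ^ j)"
      using a[OF K] by (intro tendsto_sum tendsto_mult_right) auto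
  qed
  \<comment> \<open>V_j belongs to the power r^(n-j), so the index is reversed and the ball volume
    divided out.\<close>
  define V where "V K j = (if j \<le> ?n then a (?n - j) K / unit_ball_vol (real (?n - j)) else 0)" for K j
  have ub: "unit_ball_vol (real i) > 0" for i by (rule unit_ball_vol_pos) simp
  have "steiner_coeffs K (V K)" if K: "compact_convex K" for K
    unfolding steiner_coeffs_def
  proof (intro conjI allI impI)
    fix r :: real assume r: "r \<ge> 0"
    have "measure lebesgue (parallel_body K r) = (\<Sum>j\<le>?n. a j K * r ^ j)"
      using vol_eq[OF K r] by (simp add: vol_def)
    also have "\<dots> = (\<Sum>j\<le>?n. a (?n - j) K * r ^ (?n - j))"
      by (rule sum.reindex_bij_witness[of _ "\<lambda>j. ?n - j" "\<lambda>j. ?n - j"]) auto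
    also have "\<dots> = (\<Sum>j\<le>?n. unit_ball_vol (real (?n - j)) * r ^ (?n - j) * V K j)"
      using ub by (intro sum.cong refl) (simp add: V_def less_imp_neq[symmetric] del: of_nat_diff)
    finally show "measure lebesgue (parallel_body K r)
      = (\<Sum>j\<le>?n. unit_ball_vol (real (?n - j)) * r ^ (?n - j) * V K j)" .
  qed (simp add: V_def)
  moreover have "V K j \<le> V L j" if "compact_convex K" "compact_convex L" "K \<subseteq> L" for K L j
  proof (cases "j \<le> ?n")
    case True
    have "a (?n - j) K \<le> a (?n - j) L"
      using d_mono[OF that] that by (intro LIMSEQ_le[OF a a]) auto
    then show ?thesis
      using True ub[of "?n - j"] by (simp add: V_def divide_right_mono del: of_nat_diff)
  qed (simp add: V_def)
  ultimately show ?thesis by blast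
qed

text \<open>Removes the definite description: identities for intrinsic volumes are now proved by
  exhibiting Steiner coefficients and applying \<open>intrinsic_volume_eq\<close>.\<close>

lemma steiner_coeffs_intrinsic_volume:
  assumes "compact_convex (K :: (real^'n) set)"
  shows "steiner_coeffs K (\<lambda>j. intrinsic_volume j K)"
proof -
  obtain V where "steiner_coeffs K V" using steiner_formula assms by blast
  then show ?thesis using intrinsic_volume_eq[of K V] by simp
qed

lemma intrinsic_volume_mono:
  assumes "compact_convex K" "compact_convex L" "K \<subseteq> (L :: (real^'n) set)"
  shows "intrinsic_volume j K \<le> intrinsic_volume j L"
proof -
  obtain V where "steiner_coeffs K (V K)" "steiner_coeffs L (V L)" "V K j \<le> V L j"
    using steiner_formula assms by metis
  then show ?thesis using intrinsic_volume_eq by metis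
qed

lemma intrinsic_volume_nonneg:
  "compact_convex (K :: (real^'n) set) \<Longrightarrow> intrinsic_volume j K \<ge> 0"
  using intrinsic_volume_mono[of "{}" K j] by (simp add: compact_convex_def intrinsic_volume_empty)

section \<open>Properties of intrinsic volumes\<close>

lemma measure_rigid_image:
  fixes L :: "real^'n \<Rightarrow> real^'n"
  assumes L: "orthogonal_transformation L" and S: "compact S"
  shows "measure lebesgue ((\<lambda>x. L x + b) ` S) = measure lebesgue S"
proof -
  have inv: "orthogonal_transformation (inv L)" and "bij L"
    using L orthogonal_transformation_inv orthogonal_transformation_bij by auto
  have [measurable]: "inv L \<in> borel_measurable borel"
    using inv orthogonal_transformation_linear linear_continuous_on
      borel_measurable_continuous_onI linear_conv_bounded_linear by blast
  have eq: "inv L -` S = L ` S"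
    using \<open>bij L\<close> by (metis bij_imp_bij_inv bij_vimage_eq_inv_image inv_inv_eq)
  have "compact (L ` S)"
    using L S orthogonal_transformation_linear linear_conv_bounded_linear
      compact_continuous_image linear_continuous_on by blast
  have "measure lborel (L ` S) = measure (distr lborel borel (inv L)) S"
    using S by (subst measure_distr) (auto simp: eq borel_compact)
  then have "measure lebesgue (L ` S) = measure lebesgue S"
    using S \<open>compact (L ` S)\<close> by (simp add: lborel_distr_orthogonal[OF inv] borel_compact)
  moreover have "(\<lambda>x. L x + b) ` S = (+) b ` (L ` S)"
    by (auto simp: image_image add.commute)
  ultimately show ?thesis by (simp add: measure_translation)
qed

text \<open>Rigid motions commute with forming parallel bodies and preserve volume, so the Steiner
  polynomials agree.\<close>

lemma intrinsic_volume_rigid_image: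
  fixes L :: "real^'n \<Rightarrow> real^'n"
  assumes L: "orthogonal_transformation L" and K: "compact_convex K"
  shows "intrinsic_volume j ((\<lambda>x. L x + b) ` K) = intrinsic_volume j K"
proof -
  let ?T = "\<lambda>x. L x + b"
  have lin: "linear L" and surj: "surj L"
    using L orthogonal_transformation_linear orthogonal_transformation_surj by auto
  have dist: "dist (?T x) (?T y) = dist x y" for x y
    using L by (simp add: dist_norm orthogonal_transformation_norm flip: linear_diff[OF lin])
  have "parallel_body (?T ` K) r = ?T ` parallel_body K r" for r
  proof (intro equalityI subsetI)
    fix y assume "y \<in> parallel_body (?T ` K) r"
    moreover obtain z where "y = ?T z"
      using surj by (metis diff_add_cancel surjE)
    ultimately show "y \<in> ?T ` parallel_body K r"
      by (auto simp: dist simp del: dist_add_cancel2)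
  qed (auto simp: dist simp del: dist_add_cancel2)
  moreover have "compact (parallel_body K r)" for r
    using compact_convex_parallel_body[OF K] by (simp add: compact_convex_def)
  ultimately have "steiner_coeffs (?T ` K) (\<lambda>j. intrinsic_volume j K)"
    using steiner_coeffs_intrinsic_volume[OF K]
    by (simp add: steiner_coeffs_def measure_rigid_image[OF L])
  then show ?thesis by (rule intrinsic_volume_eq)
qed

text \<open>The r-parallel body of c K is c times the (r/c)-parallel body of K, and c^n (r/c)^(n-j)
  = c^j r^(n-j).\<close>

lemma intrinsic_volume_scaleR:
  fixes K :: "(real^'n) set"
  assumes K: "compact_convex K" and c: "c > 0"
  shows "intrinsic_volume j ((*\<^sub>R) c ` K) = c ^ j * intrinsic_volume j K"
proof -
  let ?n = "CARD('n)"
  have "steiner_coeffs ((*\<^sub>R) c ` K) (\<lambda>j. c ^ j * intrinsic_volume j K)"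
    unfolding steiner_coeffs_def
  proof (intro conjI allI impI)
    fix r :: real assume r: "r \<ge> 0"
    have "parallel_body ((*\<^sub>R) c ` K) r = (*\<^sub>R) c ` parallel_body K (r / c)"
      unfolding parallel_body_eq_plus scaleR_set_plus
      using c r by (simp add: scaleR_cball_unit)
    then have "measure lebesgue (parallel_body ((*\<^sub>R) c ` K) r)
        = c ^ ?n * measure lebesgue (parallel_body K (r / c))"
      using measure_lebesgue_affine[of c 0 "parallel_body K (r / c)"] c by simp
    also have "\<dots> = c ^ ?n * (\<Sum>j\<le>?n. unit_ball_vol (real (?n - j)) * (r / c) ^ (?n - j)
        * intrinsic_volume j K)"
      using steiner_coeffs_intrinsic_volume[OF K] r c by (simp add: steiner_coeffs_def)
    also have "\<dots> = (\<Sum>j\<le>?n. unit_ball_vol (real (?n - j)) * r ^ (?n - j)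
        * (c ^ j * intrinsic_volume j K))"
      unfolding sum_distrib_left
    proof (rule sum.cong[OF refl])
      fix j assume "j \<in> {..?n}"
      then have "c ^ ?n = c ^ j * c ^ (?n - j)"
        by (simp flip: power_add)
      then show "c ^ ?n * (unit_ball_vol (real (?n - j)) * (r / c) ^ (?n - j) * intrinsic_volume j K)
         = unit_ball_vol (real (?n - j)) * r ^ (?n - j) * (c ^ j * intrinsic_volume j K)"
        using c by (simp add: power_divide del: of_nat_diff)
    qed
    finally show "measure lebesgue (parallel_body ((*\<^sub>R) c ` K) r) = \<dots>" .
  next
    fix i assume "i > ?n"
    then show "c ^ i * intrinsic_volume i K = 0"
      using steiner_coeffs_intrinsic_volume[OF K] by (simp add: steiner_coeffs_def)
  qed
  then show ?thesis by (rule intrinsic_volume_eq)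
qed

text \<open>Turns linear growth of sublevel sets into the growth t^k that the moment condition on
  \<nu> controls.\<close>

lemma intrinsic_volume_le_of_subset_cball:
  fixes K :: "(real^'n) set"
  assumes "compact_convex K" "K \<subseteq> cball a R" "R > 0"
  shows "intrinsic_volume j K \<le> R ^ j * intrinsic_volume j (cball (0::real^'n) 1)"
proof -
  have ball: "compact_convex (cball x r :: (real^'n) set)" for x r
    by (simp add: compact_convex_def)
  have id: "orthogonal_transformation (id :: real^'n \<Rightarrow> real^'n)"
    by (simp add: orthogonal_transformation_def linear_iff)
  have "cball a R = (\<lambda>x. id x + a) ` (*\<^sub>R) R ` cball 0 1"
    using assms(3) by (simp add: scaleR_cball_unit add.commute[of _ a] cong: image_cong_simp)
  then have "intrinsic_volume j (cball a R) = R ^ j * intrinsic_volume j (cball (0::real^'n) 1)"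
    using intrinsic_volume_rigid_image[OF id, of "(*\<^sub>R) R ` cball 0 1" j a]
      intrinsic_volume_scaleR[OF ball[of 0 1] assms(3), of j] assms(3)
    by (simp add: ball scaleR_cball_unit)
  then show ?thesis
    using intrinsic_volume_mono[OF assms(1) ball assms(2), of j] by simp
qed

section \<open>Additivity and continuity of intrinsic volumes\<close>

text \<open>A segment from \<open>K\<close> to \<open>L\<close> inside \<open>K \<union> L\<close> is covered by the closed sets \<open>K\<close> and \<open>L\<close>, so by
  connectedness it meets \<open>K \<inter> L\<close>.\<close>

lemma closed_segment_meets_Int:
  fixes a b :: "'a::euclidean_space"
  assumes "closed K" "closed L" "a \<in> K" "b \<in> L" "closed_segment a b \<subseteq> K \<union> L"
  shows "\<exists>z\<in>closed_segment a b. z \<in> K \<inter> L"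
  using connected_closedD[OF connected_segment(1)[of a b], of K L] assms by blast

text \<open>If y is within r of a in K and of b in L, the segment from a to b stays in the ball
  about y and in the convex union, so it contains a point of both K and L.\<close>

lemma parallel_body_Int:
  fixes K L :: "'a::euclidean_space set"
  assumes "compact_convex K" "compact_convex L" "convex (K \<union> L)"
  shows "parallel_body (K \<inter> L) r = parallel_body K r \<inter> parallel_body L r"
proof (intro equalityI subsetI)
  fix y assume "y \<in> parallel_body K r \<inter> parallel_body L r"
  then obtain a b where ab: "a \<in> K" "b \<in> L" "a \<in> cball y r" "b \<in> cball y r"
    by (auto simp: dist_commute)
  have "closed_segment a b \<subseteq> K \<union> L"
    using ab assms(3) by (intro closed_segment_subset) auto
  then obtain z where z: "z \<in> closed_segment a b" "z \<in> K \<inter> L"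
    using closed_segment_meets_Int[of K L a b] ab assms
    by (auto simp: compact_convex_def compact_imp_closed)
  have "z \<in> cball y r"
    using closed_segment_subset[OF ab(3,4) convex_cball] z by blast
  then show "y \<in> parallel_body (K \<inter> L) r"
    using z by (auto simp: dist_commute)
qed auto

text \<open>Inclusion-exclusion for the volumes of the parallel bodies holds at every r, hence
  coefficientwise.\<close>

lemma intrinsic_volume_Un_Int:
  fixes K L :: "(real^'n) set"
  assumes K: "compact_convex K" and L: "compact_convex L" and KL: "convex (K \<union> L)"
  shows "intrinsic_volume j (K \<inter> L) + intrinsic_volume j (K \<union> L)
       = intrinsic_volume j K + intrinsic_volume j L"
proof -
  let ?n = "CARD('n)"
  have KL': "compact_convex (K \<inter> L)" "compact_convex (K \<union> L)"
    using assms by (auto simp: compact_convex_def compact_Un compact_Int convex_Int)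
  note st = steiner_coeffs_intrinsic_volume[OF K] steiner_coeffs_intrinsic_volume[OF L]
    steiner_coeffs_intrinsic_volume[OF KL'(1)]
  have "steiner_coeffs (K \<union> L)
      (\<lambda>j. intrinsic_volume j K + intrinsic_volume j L - intrinsic_volume j (K \<inter> L))"
    unfolding steiner_coeffs_def
  proof (intro conjI allI impI)
    fix r :: real assume r: "r \<ge> 0"
    have lm: "parallel_body M r \<in> lmeasurable" if "compact_convex M" for M :: "(real^'n) set"
      using that by (intro compact_convex_lmeasurable compact_convex_parallel_body)
    have "parallel_body (K \<union> L) r = parallel_body K r \<union> parallel_body L r" by auto
    then have "measure lebesgue (parallel_body (K \<union> L) r) = measure lebesgue (parallel_body K r)
        + measure lebesgue (parallel_body L r) - measure lebesgue (parallel_body (K \<inter> L) r)"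
      unfolding parallel_body_Int[OF assms] by (simp add: measure_Un3 lm K L)
    then show "measure lebesgue (parallel_body (K \<union> L) r) = (\<Sum>j\<le>?n. unit_ball_vol (real (?n - j))
        * r ^ (?n - j) * (intrinsic_volume j K + intrinsic_volume j L - intrinsic_volume j (K \<inter> L)))"
      using st r by (simp add: steiner_coeffs_def distrib_left right_diff_distrib sum.distrib sum_subtractf)
  qed (use st in \<open>simp add: steiner_coeffs_def\<close>)
  then show ?thesis using intrinsic_volume_eq[of "K \<union> L"] by fastforce
qed

text \<open>The union of the parallel bodies need not be closed, but it is convex and dense in the
  parallel body of L, and the frontier of a convex set is negligible.\<close>

lemma measure_parallel_body_incseq:
  fixes K :: "nat \<Rightarrow> 'a::euclidean_space set"
  assumes K: "\<And>i. compact_convex (K i)" and inc: "incseq K"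
    and L: "compact_convex L" "closure (\<Union>i. K i) = L"
  shows "(\<lambda>i. measure lebesgue (parallel_body (K i) r)) \<longlonglongrightarrow> measure lebesgue (parallel_body L r)"
proof -
  define P where "P = (\<Union>i. parallel_body (K i) r)"
  have cc: "compact_convex (parallel_body (K i) r)" "compact_convex (parallel_body L r)" for i
    using K L by (auto intro: compact_convex_parallel_body)
  have sub: "P \<subseteq> parallel_body L r"
    using closure_subset[of "\<Union>i. K i"] unfolding P_def L(2) by blast
  have incP: "incseq (\<lambda>i. parallel_body (K i) r)"
    using inc unfolding incseq_def by blast
  have "convex P"
    unfolding P_def
  proof (rule convexI)
    fix x y u v
    assume xy: "x \<in> (\<Union>i. parallel_body (K i) r)" "y \<in> (\<Union>i. parallel_body (K i) r)"
      and uv: "0 \<le> u" "0 \<le> v" "u + v = (1::real)"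
    obtain i j where "x \<in> parallel_body (K i) r" "y \<in> parallel_body (K j) r"
      using xy by blast
    then have "x \<in> parallel_body (K (max i j)) r" "y \<in> parallel_body (K (max i j)) r"
      using subsetD[OF incseqD[OF incP max.cobounded1[of i j]]]
        subsetD[OF incseqD[OF incP max.cobounded2[of j i]]] by blast+
    then have "u *\<^sub>R x + v *\<^sub>R y \<in> parallel_body (K (max i j)) r"
      using cc(1)[of "max i j"] uv by (auto simp only: compact_convex_def intro: convexD)
    then show "u *\<^sub>R x + v *\<^sub>R y \<in> (\<Union>i. parallel_body (K i) r)" by blast
  qed
  have "parallel_body L r \<subseteq> closure P"
  proof
    fix y assume "y \<in> parallel_body L r"
    then obtain x where x: "x \<in> closure (\<Union>i. K i)" "dist x y \<le> r"
      using L(2) by auto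
    show "y \<in> closure P"
      unfolding closure_approachable
    proof (intro allI impI)
      fix e :: real assume "e > 0"
      then obtain z i where z: "z \<in> K i" "dist z x < e"
        using x(1) unfolding closure_approachable by blast
      \<comment> \<open>The offset y - x is kept while its base point moves from x to the nearby
        z.\<close>
      have "dist z (z + (y - x)) \<le> r"
        using x(2) by (simp add: dist_norm norm_minus_commute)
      then have "z + (y - x) \<in> P"
        unfolding P_def using z(1) mem_cball by blast
      moreover have "dist (z + (y - x)) y < e"
        using z(2) by (simp add: dist_norm algebra_simps)
      ultimately show "\<exists>w\<in>P. dist w y < e" by blast
    qed
  qed
  have bounded: "bounded P"
    using bounded_subset[OF _ sub] cc(2) by (simp add: compact_convex_def compact_imp_bounded)
  have "closure P = parallel_body L r"
    using \<open>parallel_body L r \<subseteq> closure P\<close> closure_minimal[OF sub] cc(2)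
    by (auto simp: compact_convex_def compact_imp_closed)
  moreover have "measure lebesgue (closure P) = measure lebesgue P"
    using \<open>convex P\<close> bounded by (intro measure_closure negligible_convex_frontier)
  moreover have "(\<lambda>i. measure lebesgue (parallel_body (K i) r)) \<longlonglongrightarrow> measure lebesgue P"
    unfolding P_def
  proof (rule Lim_measure_incseq[OF _ incP])
    show "range (\<lambda>i. parallel_body (K i) r) \<subseteq> sets lebesgue"
      using cc(1) compact_convex_lmeasurable fmeasurableD by blast
    have "P \<in> lmeasurable"
      using \<open>convex P\<close> bounded by (rule measurable_convex)
    then show "emeasure lebesgue (\<Union>i. parallel_body (K i) r) \<noteq> \<infinity>"
      using fmeasurableD2 infinity_ennreal_def by (metis P_def)
  qed
  ultimately show ?thesis by simp
qed

text \<open>Each V_j (K i) is increasing and bounded, hence convergent. Passing to the limit in the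
  Steiner formula shows that the limits are Steiner coefficients of L.\<close>

lemma intrinsic_volume_incseq:
  fixes K :: "nat \<Rightarrow> (real^'n) set"
  assumes K: "\<And>i. compact_convex (K i)" and inc: "incseq K"
    and L: "compact_convex L" "closure (\<Union>i. K i) = L"
  shows "(\<lambda>i. intrinsic_volume j (K i)) \<longlonglongrightarrow> intrinsic_volume j L"
proof -
  let ?n = "CARD('n)"
  have sub: "K i \<subseteq> L" for i
    using closure_subset[of "\<Union>i. K i"] unfolding L(2) by blast
  define l where "l j = lim (\<lambda>i. intrinsic_volume j (K i))" for j
  have l: "(\<lambda>i. intrinsic_volume j (K i)) \<longlonglongrightarrow> l j" for j
  proof -
    have "incseq (\<lambda>i. intrinsic_volume j (K i))"
      using inc K by (auto simp: incseq_def intro!: intrinsic_volume_mono)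
    moreover have "intrinsic_volume j (K i) \<le> intrinsic_volume j L" for i
      using K L sub by (intro intrinsic_volume_mono) auto
    ultimately have "convergent (\<lambda>i. intrinsic_volume j (K i))"
      using incseq_convergent convergentI by metis
    then show ?thesis by (simp add: l_def convergent_LIMSEQ_iff)
  qed
  have "steiner_coeffs L l"
    unfolding steiner_coeffs_def
  proof (intro conjI allI impI)
    fix r :: real assume r: "r \<ge> 0"
    have "(\<lambda>i. measure lebesgue (parallel_body (K i) r)) \<longlonglongrightarrow>
       (\<Sum>j\<le>?n. unit_ball_vol (real (?n - j)) * r ^ (?n - j) * l j)"
      using steiner_coeffs_intrinsic_volume[OF K] r
      by (simp add: steiner_coeffs_def) (intro tendsto_sum tendsto_mult_left l)
    then show "measure lebesgue (parallel_body L r)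
        = (\<Sum>j\<le>?n. unit_ball_vol (real (?n - j)) * r ^ (?n - j) * l j)"
      using LIMSEQ_unique measure_parallel_body_incseq[OF assms] by blast
  next
    fix j assume "j > ?n"
    then have "intrinsic_volume j (K i) = 0" for i
      using steiner_coeffs_intrinsic_volume[OF K[of i]] by (simp add: steiner_coeffs_def)
    then show "l j = 0" by (simp add: l_def)
  qed
  then show ?thesis using l intrinsic_volume_eq by metis
qed

section \<open>Sublevel sets of convex functions\<close>

lemma lower_semicontinuous_iff_closed_sublevel:
  fixes u :: "'a::topological_space \<Rightarrow> ereal"
  shows "lower_semicontinuous u \<longleftrightarrow> (\<forall>s. closed {x. u x \<le> s})"
proof
  assume lsc: "lower_semicontinuous u"
  have "open {x. s < u x}" for s
  proof (subst open_subopen, intro ballI)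
    fix x assume "x \<in> {x. s < u x}"
    \<comment> \<open>The Liminf ignores the point x, so its own value is needed to get a full
      neighbourhood.\<close>
    then have "s < Liminf (at x) u" "s < u x"
      using lsc by (auto simp: lower_semicontinuous_def intro: less_le_trans)
    then have "\<forall>\<^sub>F y in nhds x. s < u y"
      using less_LiminfD by (auto simp: eventually_nhds_conv_at)
    then show "\<exists>T. open T \<and> x \<in> T \<and> T \<subseteq> {x. s < u x}"
      by (auto simp: eventually_nhds)
  qed
  moreover have "{x. u x \<le> s} = - {x. s < u x}" for s by auto
  ultimately show "\<forall>s. closed {x. u x \<le> s}" by (simp add: closed_def)
next
  assume closed: "\<forall>s. closed {x. u x \<le> s}"
  show "lower_semicontinuous u"
    unfolding lower_semicontinuous_def le_Liminf_iff
  proof (intro allI impI)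
    fix x s assume "s < u x"
    have "- {x. u x \<le> s} = {x. s < u x}" by auto
    then have "open {x. s < u x}"
      using closed by (metis open_Compl)
    then show "\<forall>\<^sub>F y in at x. s < u y"
      using \<open>s < u x\<close> by (auto simp: eventually_at_topological)
  qed
qed

lemma tendsto_infinity_at_infinity_iff:
  fixes u :: "'a::real_normed_vector \<Rightarrow> ereal"
  shows "(u \<longlongrightarrow> \<infinity>) at_infinity \<longleftrightarrow> (\<forall>s::real. bounded {x. u x \<le> ereal s})"
proof -
  have "(\<exists>b. \<forall>x. b \<le> norm x \<longrightarrow> ereal s < u x) \<longleftrightarrow> bounded {x. u x \<le> ereal s}" for s
  proof
    assume "\<exists>b. \<forall>x. b \<le> norm x \<longrightarrow> ereal s < u x"
    then obtain b where "\<And>x. b \<le> norm x \<Longrightarrow> ereal s < u x" by blast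
    then show "bounded {x. u x \<le> ereal s}"
      unfolding bounded_iff by (metis linorder_le_cases mem_Collect_eq not_le)
  next
    assume "bounded {x. u x \<le> ereal s}"
    then obtain b where "\<And>x. u x \<le> ereal s \<Longrightarrow> norm x \<le> b"
      unfolding bounded_iff by auto
    then show "\<exists>b. \<forall>x. b \<le> norm x \<longrightarrow> ereal s < u x"
      by (intro exI[of _ "b + 1"] allI impI) (metis add_le_same_cancel1 not_le not_one_le_zero order.trans)
  qed
  then show ?thesis by (simp add: tendsto_PInfty eventually_at_infinity)
qed

text \<open>Lower semicontinuity gives closed sublevel sets, coercivity bounded ones. Real levels
  suffice: level \<infinity> gives the whole space, and level -\<infinity> the empty set.\<close>

lemma conv_funs_iff:
  "u \<in> conv_funs \<longleftrightarrow> (\<forall>x. u x \<noteq> - \<infinity>) \<and> ereal_convex u \<and> (\<forall>s::real. compact {x. u x \<le> ereal s})"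
proof -
  have "(\<forall>s. closed {x. u x \<le> s}) \<longleftrightarrow> (\<forall>s::real. closed {x. u x \<le> ereal s})"
    if "\<forall>x. u x \<noteq> - \<infinity>"
  proof
    assume r: "\<forall>s::real. closed {x. u x \<le> ereal s}"
    show "\<forall>s. closed {x. u x \<le> s}"
    proof
      fix s :: ereal
      show "closed {x. u x \<le> s}"
        using r that by (cases s) auto
    qed
  qed simp
  then show ?thesis
    by (auto simp: conv_funs_def lower_semicontinuous_iff_closed_sublevel
        tendsto_infinity_at_infinity_iff compact_eq_bounded_closed)
qed

section \<open>Convexity and size of sublevel sets\<close>

lemma ereal_convexD:
  assumes "ereal_convex u" "u x \<le> ereal p" "u y \<le> ereal q" "0 < s" "s < 1"
  shows "u (s *\<^sub>R x + (1 - s) *\<^sub>R y) \<le> ereal (s * p + (1 - s) * q)"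
proof -
  have "u (s *\<^sub>R x + (1 - s) *\<^sub>R y) \<le> ereal s * u x + ereal (1 - s) * u y"
    using assms by (auto simp: ereal_convex_def)
  also have "\<dots> \<le> ereal s * ereal p + ereal (1 - s) * ereal q"
    using assms by (intro add_mono ereal_mult_left_mono) auto
  finally show ?thesis by simp
qed

lemma convex_le_sublevel:
  assumes "ereal_convex u"
  shows "convex {x. u x \<le> ereal t}"
proof (rule convexI)
  fix x y and a b :: real
  assume xy: "x \<in> {x. u x \<le> ereal t}" "y \<in> {x. u x \<le> ereal t}"
    and ab: "0 \<le> a" "0 \<le> b" "a + b = 1"
  have b: "b = 1 - a" using ab by simp
  show "a *\<^sub>R x + b *\<^sub>R y \<in> {x. u x \<le> ereal t}"
  proof (cases "a = 0 \<or> a = 1")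
    case False
    then show ?thesis
      using ereal_convexD[OF assms, of x t y t a] xy ab
      by (simp add: b) (simp add: algebra_simps)
  qed (use xy b in auto)
qed

lemma convex_less_sublevel:
  assumes "ereal_convex u"
  shows "convex {x. u x < ereal t}"
proof (rule convexI)
  fix x y and a b :: real
  assume xy: "x \<in> {x. u x < ereal t}" "y \<in> {x. u x < ereal t}"
    and ab: "0 \<le> a" "0 \<le> b" "a + b = 1"
  \<comment> \<open>Real levels strictly below t reduce the claim to a non-strict sublevel
    set.\<close>
  obtain p where p: "u x \<le> ereal p" "p < t"
    using xy ereal_dense2[of "u x" "ereal t"] by (auto intro: less_imp_le)
  obtain q where q: "u y \<le> ereal q" "q < t"
    using xy ereal_dense2[of "u y" "ereal t"] by (auto intro: less_imp_le)
  have "convex {x. u x \<le> ereal (max p q)}"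
    by (rule convex_le_sublevel[OF assms])
  moreover have "u x \<le> ereal (max p q)" "u y \<le> ereal (max p q)"
    using p(1) q(1) by (auto intro: order.trans)
  ultimately have "u (a *\<^sub>R x + b *\<^sub>R y) \<le> ereal (max p q)"
    using ab convexD[of "{x. u x \<le> ereal (max p q)}" x y a b] by simp
  also have "\<dots> < ereal t" using p q by simp
  finally show "a *\<^sub>R x + b *\<^sub>R y \<in> {x. u x < ereal t}" by simp
qed

lemma convex_eff_dom:
  assumes "u \<in> conv_funs"
  shows "convex (eff_dom u)"
proof (rule convexI)
  fix x y and a b :: real
  assume "x \<in> eff_dom u" "y \<in> eff_dom u" and ab: "0 \<le> a" "0 \<le> b" "a + b = 1"
  then obtain p q where "u x = ereal p" "u y = ereal q"
    using assms by (cases "u x"; cases "u y") (auto simp: conv_funs_iff eff_dom_def)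
  then have "u (a *\<^sub>R x + b *\<^sub>R y) \<le> ereal (max p q)"
    using assms convexD[OF convex_le_sublevel[of u "max p q"], of x y a b] ab
    by (simp add: conv_funs_iff)
  then show "a *\<^sub>R x + b *\<^sub>R y \<in> eff_dom u"
    unfolding eff_dom_def mem_Collect_eq by (rule le_less_trans) (simp add: max_def)
qed

lemma compact_convex_closure_sublevel:
  assumes u: "u \<in> conv_funs"
  shows "compact_convex (closure {x. u x < ereal t})"
proof -
  have "bounded {x. u x < ereal t}"
  proof (rule bounded_subset)
    show "bounded {x. u x \<le> ereal t}"
      using u by (simp add: conv_funs_iff compact_imp_bounded)
  qed (auto simp: less_imp_le)
  then show ?thesis
    using u convex_less_sublevel[of u t]
    by (simp add: conv_funs_iff compact_convex_def convex_closure compact_closure)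
qed

text \<open>Otherwise the compact sets {u \<le> -i} would be nested and nonempty, and u would be
  -\<infinity> at a common point.\<close>

lemma conv_funs_bounded_below:
  assumes u: "u \<in> conv_funs"
  shows "\<exists>m::real. \<forall>t<m. {x. u x < ereal t} = {}"
proof -
  define F where "F i = {x. u x \<le> ereal (- real i)}" for i :: nat
  have "\<exists>i. F i = {}"
  proof (rule ccontr)
    assume "\<nexists>i. F i = {}"
    moreover have "F n \<subseteq> F m" if "m \<le> n" for m n
      using that by (auto simp: F_def elim!: order.trans)
    moreover have "compact (F i)" for i
      using u by (auto simp: F_def conv_funs_iff)
    ultimately have "\<Inter>(range F) \<noteq> {}"
      by (intro compact_nest) auto
    then obtain x where x: "\<And>i. u x \<le> ereal (- real i)" by (auto simp: F_def)
    have "u x \<le> ereal B" for B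
    proof -
      obtain i where "- B \<le> real i" using real_arch_simple by blast
      then show ?thesis using x[of i] by (meson ereal_less_eq(3) minus_le_iff order.trans)
    qed
    then have "u x = - \<infinity>" by (rule ereal_bot)
    then show False using u by (simp add: conv_funs_iff)
  qed
  then obtain i where "F i = {}" by blast
  then have "{x. u x < ereal t} = {}" if "t < - real i" for t
    using that less_imp_le[of t "- real i"] unfolding F_def
    by (smt (verit, del_insts) Collect_empty_eq ereal_less_eq(3) less_imp_le order.trans)
  then show ?thesis by blast
qed

text \<open>If \<open>u x\<^sub>0 = p\<close> and \<open>{u \<le> p + 1}\<close> lies in the ball of radius \<open>R\<close> about \<open>x\<^sub>0\<close>, then convexity gives
  \<open>{u < t} \<subseteq> cball x\<^sub>0 (R max 1 (t - p))\<close>.\<close>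

lemma sublevel_linear_growth:
  assumes u: "u \<in> conv_funs"
  shows "\<exists>a A. A > 0 \<and> (\<forall>t\<ge>1. closure {x. u x < ereal t} \<subseteq> cball a (A * t))"
proof (cases "\<exists>x. u x \<noteq> \<infinity>")
  case False
  then show ?thesis by (intro exI[of _ 0] exI[of _ 1]) auto
next
  case True
  then obtain x0 p where p: "u x0 = ereal p"
    using u by (metis conv_funs_iff ereal_cases)
  have cu: "ereal_convex u" using u by (simp add: conv_funs_iff)
  have "bounded {x. u x \<le> ereal (p + 1)}"
    using u compact_imp_bounded by (auto simp: conv_funs_iff)
  then obtain R' where R': "\<And>x. u x \<le> ereal (p + 1) \<Longrightarrow> norm (x - x0) \<le> R'"
    unfolding bounded_any_center[of _ x0] by (auto simp: dist_norm norm_minus_commute)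
  define R where "R = max 1 R'"
  have R: "R > 0" "\<And>x. u x \<le> ereal (p + 1) \<Longrightarrow> norm (x - x0) \<le> R"
    using R' by (auto simp: R_def le_max_iff_disj)
  have "dist x0 x \<le> R * (1 + \<bar>p\<bar>) * t" if t: "t \<ge> 1" and x: "u x < ereal t" for x t
  proof -
    \<comment> \<open>Contracting x towards \<open>x0\<close> by 1/M brings the value of u down to
      at most p + (t - p)/M \<le> p + 1.\<close>
    define M where "M = max 1 (t - p)"
    have M: "M \<ge> 1" "t - p \<le> M" by (auto simp: M_def)
    have "u ((1 / M) *\<^sub>R x + (1 - 1 / M) *\<^sub>R x0) \<le> ereal (p + 1)"
    proof (cases "M = 1")
      case True
      then show ?thesis using M x by (auto intro: order.trans[OF less_imp_le])
    next
      case False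
      then have "u ((1 / M) *\<^sub>R x + (1 - 1 / M) *\<^sub>R x0) \<le> ereal ((1 / M) * t + (1 - 1 / M) * p)"
        using M x p by (intro ereal_convexD[OF cu]) auto
      also have "(1 / M) * t + (1 - 1 / M) * p = p + (t - p) / M"
        using M by (simp add: field_simps)
      also have "ereal \<dots> \<le> ereal (p + 1)" using M by simp
      finally show ?thesis .
    qed
    then have "norm ((1 / M) *\<^sub>R x + (1 - 1 / M) *\<^sub>R x0 - x0) \<le> R" by (rule R(2))
    also have "(1 / M) *\<^sub>R x + (1 - 1 / M) *\<^sub>R x0 - x0 = (1 / M) *\<^sub>R (x - x0)"
      by (simp add: algebra_simps)
    finally have "norm (x - x0) \<le> R * M"
      using M by (simp add: pos_divide_le_eq)
    also have "\<dots> \<le> R * ((1 + \<bar>p\<bar>) * t)"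
    proof (rule mult_left_mono)
      have "\<bar>p\<bar> * 1 \<le> \<bar>p\<bar> * t" using t by (intro mult_left_mono) auto
      then show "M \<le> (1 + \<bar>p\<bar>) * t" using t by (auto simp: M_def algebra_simps)
    qed (use R in simp)
    finally show ?thesis by (simp add: dist_norm norm_minus_commute mult.assoc)
  qed
  then have "closure {x. u x < ereal t} \<subseteq> cball x0 (R * (1 + \<bar>p\<bar>) * t)" if "t \<ge> 1" for t
    using that by (intro closure_minimal) auto
  moreover have "R * (1 + \<bar>p\<bar>) > 0" using R by simp
  ultimately show ?thesis by blast
qed

section \<open>Operations on the function class and closures of sublevel sets\<close>

lemma conv_funs_max:
  assumes u: "u \<in> conv_funs" and v: "v \<in> conv_funs"
  shows "(\<lambda>x. max (u x) (v x)) \<in> conv_funs"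
  unfolding conv_funs_iff
proof (intro conjI allI)
  show "max (u x) (v x) \<noteq> - \<infinity>" for x
    using u v by (simp add: conv_funs_iff max_def)
  have "w (s *\<^sub>R x + (1 - s) *\<^sub>R y) \<le> ereal s * max (u x) (v x) + ereal (1 - s) * max (u y) (v y)"
    if "w = u \<or> w = v" "0 < s" "s < 1" for w x y s
  proof -
    have "w (s *\<^sub>R x + (1 - s) *\<^sub>R y) \<le> ereal s * w x + ereal (1 - s) * w y"
      using that u v by (auto simp: conv_funs_iff ereal_convex_def)
    also have "\<dots> \<le> ereal s * max (u x) (v x) + ereal (1 - s) * max (u y) (v y)"
      using that by (intro add_mono ereal_mult_left_mono) auto
    finally show ?thesis .
  qed
  then show "ereal_convex (\<lambda>x. max (u x) (v x))"
    by (simp add: ereal_convex_def)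
  fix s :: real
  have "{x. max (u x) (v x) \<le> ereal s} = {x. u x \<le> ereal s} \<inter> {x. v x \<le> ereal s}" by auto
  then show "compact {x. max (u x) (v x) \<le> ereal s}"
    using u v by (simp add: conv_funs_iff compact_Int)
qed

text \<open>The sublevel sets are images under \<open>S\<close> of those of u, hence compact. Serves
  rigid motions and dilations alike.\<close>

lemma conv_funs_compose_affine:
  fixes T S :: "real^'n \<Rightarrow> real^'n"
  assumes u: "u \<in> conv_funs"
    and T: "\<And>x y s. T (s *\<^sub>R x + (1 - s) *\<^sub>R y) = s *\<^sub>R T x + (1 - s) *\<^sub>R T y"
    and S: "continuous_on UNIV S" and inv: "\<And>x. S (T x) = x" "\<And>x. T (S x) = x"
  shows "(\<lambda>x. u (T x)) \<in> conv_funs"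
  unfolding conv_funs_iff
proof (intro conjI allI)
  fix s :: real
  have "{x. u (T x) \<le> ereal s} = S ` {x. u x \<le> ereal s}"
    using inv by (auto simp: image_iff) metis
  then show "compact {x. u (T x) \<le> ereal s}"
    using u continuous_on_subset[OF S]
    by (auto simp: conv_funs_iff intro!: compact_continuous_image)
qed (use u T in \<open>auto simp: conv_funs_iff ereal_convex_def\<close>)

lemma conv_funs_infinity: "(\<lambda>x. \<infinity>) \<in> conv_funs"
  by (simp add: conv_funs_iff ereal_convex_def)

text \<open>Convexity of the minimum is what makes closure commute with this intersection: if a and
  b are near x with u a < t and v b < t, the segment between them contains a point where both
  functions are below t.\<close>

lemma closure_sublevel_max:
  assumes u: "u \<in> conv_funs" and v: "v \<in> conv_funs"
    and w: "(\<lambda>x. min (u x) (v x)) \<in> conv_funs"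
  shows "closure {x. max (u x) (v x) < ereal t}
       = closure {x. u x < ereal t} \<inter> closure {x. v x < ereal t}"
proof
  show "closure {x. max (u x) (v x) < ereal t}
      \<subseteq> closure {x. u x < ereal t} \<inter> closure {x. v x < ereal t}"
    by (intro Int_greatest closure_mono) auto
next
  have meet: "\<exists>z\<in>closed_segment a b. u z < ereal t \<and> v z < ereal t"
    if ab: "u a < ereal t" "v b < ereal t" for a b
  proof -
    obtain p where p: "u a \<le> ereal p" "p < t"
      using ab ereal_dense2[of "u a" "ereal t"] by (auto intro: less_imp_le)
    obtain q where q: "v b \<le> ereal q" "q < t"
      using ab ereal_dense2[of "v b" "ereal t"] by (auto intro: less_imp_le)
    \<comment> \<open>Connectedness needs closed sets, so the argument runs at a level s < t with
      non-strict inequalities.\<close>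
    define s where "s = max p q"
    have s: "u a \<le> ereal s" "v b \<le> ereal s" "s < t"
      using p q by (auto simp: s_def intro: order.trans)
    have "closed_segment a b \<subseteq> {x. min (u x) (v x) \<le> ereal s}"
      using w s by (intro closed_segment_subset convex_le_sublevel) (auto simp: conv_funs_iff min_le_iff_disj)
    also have "\<dots> = {x. u x \<le> ereal s} \<union> {x. v x \<le> ereal s}"
      by (auto simp: min_le_iff_disj)
    finally obtain z where z: "z \<in> closed_segment a b" "u z \<le> ereal s" "v z \<le> ereal s"
      using closed_segment_meets_Int[of "{x. u x \<le> ereal s}" "{x. v x \<le> ereal s}" a b] u v s
      by (auto simp: conv_funs_iff compact_imp_closed)
    then show ?thesis
      using s(3) by (intro bexI[of _ z]) (auto intro: le_less_trans)
  qed
  show "closure {x. u x < ereal t} \<inter> closure {x. v x < ereal t}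
      \<subseteq> closure {x. max (u x) (v x) < ereal t}"
  proof
    fix x assume x: "x \<in> closure {x. u x < ereal t} \<inter> closure {x. v x < ereal t}"
    show "x \<in> closure {x. max (u x) (v x) < ereal t}"
      unfolding closure_approachable
    proof (intro allI impI)
      fix e :: real assume "e > 0"
      obtain a where a: "u a < ereal t" "a \<in> ball x e"
        using x \<open>e > 0\<close> closure_approachable[of x "{x. u x < ereal t}"] by (auto simp: dist_commute)
      obtain b where b: "v b < ereal t" "b \<in> ball x e"
        using x \<open>e > 0\<close> closure_approachable[of x "{x. v x < ereal t}"] by (auto simp: dist_commute)
      obtain z where z: "z \<in> closed_segment a b" "u z < ereal t" "v z < ereal t"
        using meet[OF a(1) b(1)] by blast
      then have "z \<in> ball x e"
        using closed_segment_subset[OF a(2) b(2) convex_ball] by blast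
      then show "\<exists>y\<in>{x. max (u x) (v x) < ereal t}. dist y x < e"
        using z by (auto simp: dist_commute intro!: bexI[of _ z])
    qed
  qed
qed

text \<open>Convergence is known only on the relative interior of the domain. A point with u x < t
  is therefore moved slightly towards a relative interior point; convexity keeps the value below
  t.\<close>

lemma closure_UN_sublevels:
  fixes u :: "real^'n \<Rightarrow> ereal" and U :: "nat \<Rightarrow> real^'n \<Rightarrow> ereal"
  assumes u: "u \<in> conv_funs" and ge: "\<And>i x. u x \<le> U i x"
    and lim: "\<And>x. x \<in> rel_interior (eff_dom u) \<Longrightarrow> (\<lambda>i. U i x) \<longlonglongrightarrow> u x"
  shows "closure (\<Union>i. closure {x. U i x < ereal t}) = closure {x. u x < ereal t}"
proof (intro equalityI closure_minimal closed_closure UN_least)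
  have "{x. U i x < ereal t} \<subseteq> {x. u x < ereal t}" for i
    using ge by (auto intro: le_less_trans)
  then show "{x. U i x < ereal t} \<subseteq> closure {x. u x < ereal t}" for i
    using closure_subset by (rule order.trans)
  have cu: "ereal_convex u" using u by (simp add: conv_funs_iff)
  have "{x. u x < ereal t} \<subseteq> closure (\<Union>i. {x. U i x < ereal t})"
  proof
    fix x assume "x \<in> {x. u x < ereal t}"
    then obtain p where p: "u x = ereal p" "p < t"
      using u by (cases "u x") (auto simp: conv_funs_iff)
    have dom: "convex (eff_dom u)" "x \<in> eff_dom u"
      using convex_eff_dom[OF u] by (auto simp: eff_dom_def p)
    then obtain y where y: "y \<in> rel_interior (eff_dom u)"
      using rel_interior_eq_empty by blast
    then obtain q where q: "u y = ereal q"
      using u rel_interior_subset by (cases "u y") (auto simp: conv_funs_iff eff_dom_def)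
    show "x \<in> closure (\<Union>i. {x. U i x < ereal t})"
      unfolding closure_approachable
    proof (intro allI impI)
      fix d :: real assume "d > 0"
      have "((\<lambda>e. e * norm (x - y)) \<longlongrightarrow> 0 * norm (x - y)) (at_right 0)"
        "((\<lambda>e. e * q + (1 - e) * p) \<longlongrightarrow> 0 * q + (1 - 0) * p) (at_right 0)"
        by (intro tendsto_intros)+
      then have "\<forall>\<^sub>F e in at_right 0. e * norm (x - y) < d"
        "\<forall>\<^sub>F e in at_right 0. e * q + (1 - e) * p < t"
        using \<open>d > 0\<close> p(2) by (auto dest: order_tendstoD(2))
      moreover have "\<forall>\<^sub>F e in at_right 0. e \<in> {0<..<1::real}"
        by (rule eventually_at_right_real) simp
      ultimately have "\<forall>\<^sub>F e in at_right 0. e * norm (x - y) < d \<and> e * q + (1 - e) * p < t \<and> e \<in> {0<..<1}"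
        by (intro eventually_conj)
      then obtain e where e: "e * norm (x - y) < d" "e * q + (1 - e) * p < t" "0 < e" "e < 1"
        using eventually_happens'[OF trivial_limit_at_right_real] by auto
      define z where "z = e *\<^sub>R y + (1 - e) *\<^sub>R x"
      have "z = x - e *\<^sub>R (x - y)" by (simp add: z_def algebra_simps)
      then have "z \<in> rel_interior (eff_dom u)"
        using rel_interior_convex_shrink[OF dom(1) y dom(2), of e] e by simp
      moreover have "u z < ereal t"
        using ereal_convexD[OF cu, of y q x p e] e p q by (auto simp: z_def intro: le_less_trans)
      ultimately have "\<forall>\<^sub>F i in sequentially. U i z < ereal t"
        using order_tendstoD(2)[OF lim] by blast
      then obtain i where "U i z < ereal t"
        by (auto simp: eventually_sequentially)
      moreover have "dist z x < d"
        using e \<open>z = x - e *\<^sub>R (x - y)\<close> by (simp add: dist_norm)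
      ultimately show "\<exists>y\<in>(\<Union>i. {x. U i x < ereal t}). dist y x < d" by blast
    qed
  qed
  also have "\<dots> \<subseteq> closure (\<Union>i. closure {x. U i x < ereal t})"
    by (intro closure_mono UN_mono closure_subset) simp
  finally show "{x. u x < ereal t} \<subseteq> closure (\<Union>i. closure {x. U i x < ereal t})" .
qed

section \<open>The integral functional\<close>

lemma intrinsic_volume_sublevel_nonneg:
  "u \<in> conv_funs \<Longrightarrow> intrinsic_volume k (closure {x. u x < ereal t}) \<ge> 0"
  by (intro intrinsic_volume_nonneg compact_convex_closure_sublevel)

text \<open>\<nu> may have infinite mass towards -\<infinity>, and the moment condition only
  concerns t > 0; the integrand vanishes at low levels because u is bounded below.\<close>

lemma integrable_intrinsic_volume_sublevel:
  fixes u :: "real^'n \<Rightarrow> ereal"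
  assumes "radon_measure \<nu>" and fin: "(\<integral>\<^sup>+t\<in>{0<..}. ennreal (t ^ k) \<partial>\<nu>) < \<infinity>"
    and u: "u \<in> conv_funs"
  shows "integrable \<nu> (\<lambda>t. intrinsic_volume k (closure {x. u x < ereal t}))"
proof -
  define F where "F t = intrinsic_volume k (closure {x. u x < ereal t})" for t
  note cc = compact_convex_closure_sublevel[OF u]
  have sets: "sets \<nu> = sets borel" and cpt: "\<And>K. compact K \<Longrightarrow> emeasure \<nu> K < \<infinity>"
    using assms(1) by (auto simp: radon_measure_def)
  have F0: "F t \<ge> 0" for t
    unfolding F_def by (rule intrinsic_volume_sublevel_nonneg[OF u])
  have mono: "mono F"
    unfolding F_def by (intro monoI intrinsic_volume_mono cc closure_mono) (auto intro: less_le_trans)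
  have Fm: "F \<in> borel_measurable \<nu>"
    using borel_measurable_mono[OF mono] measurable_cong_sets[OF sets refl] by blast
  obtain m :: real where m: "\<And>t. t < m \<Longrightarrow> {x. u x < ereal t} = {}"
    using conv_funs_bounded_below[OF u] by blast
  obtain a A where A: "A > 0" "\<And>t. t \<ge> 1 \<Longrightarrow> closure {x. u x < ereal t} \<subseteq> cball a (A * t)"
    using sublevel_linear_growth[OF u] by blast
  define D where "D = A ^ k * intrinsic_volume k (cball (0::real^'n) 1)"
  have D0: "D \<ge> 0"
    using A by (auto simp: D_def compact_convex_def intro!: mult_nonneg_nonneg intrinsic_volume_nonneg)
  \<comment> \<open>Up to t = 1 monotonicity bounds the integrand by F 1 on a set of finite measure;
    from t = 1 on the growth of sublevel sets bounds it by D t^k.\<close>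
  define g where "g t = F 1 * indicator {m..1} t + D * (indicator {0<..} t * t ^ k)" for t
  have le: "F t \<le> g t" for t
  proof -
    consider "t < m" | "m \<le> t" "t \<le> 1" | "t \<ge> 1" by linarith
    then show ?thesis
    proof cases
      case 1
      then have "F t = 0" by (simp add: F_def m intrinsic_volume_empty)
      then show ?thesis using F0[of 1] D0 by (simp add: g_def indicator_def)
    next
      case 2
      have "F t \<le> F 1" using monoD[OF mono 2(2)] .
      then show ?thesis using 2 D0 by (simp add: g_def indicator_def add_increasing2)
    next
      case 3
      have "F t \<le> (A * t) ^ k * intrinsic_volume k (cball (0::real^'n) 1)"
        unfolding F_def using A 3 by (intro intrinsic_volume_le_of_subset_cball[OF cc]) auto
      also have "\<dots> = D * t ^ k" by (simp add: D_def power_mult_distrib)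
      finally show ?thesis using 3 F0[of 1] D0 by (simp add: g_def indicator_def)
    qed
  qed
  have "integrable \<nu> (indicator {m..1} :: real \<Rightarrow> real)"
    using cpt[of "{m..1}"] by (intro integrable_real_indicator) (auto simp: sets)
  moreover have "integrable \<nu> (\<lambda>t. indicator {0<..} t * t ^ k :: real)"
  proof (rule integrableI_bounded)
    show "(\<lambda>t. indicator {0<..} t * t ^ k :: real) \<in> borel_measurable \<nu>"
      unfolding measurable_cong_sets[OF sets refl] by measurable
    have "(\<integral>\<^sup>+t. ennreal (norm (indicator {0<..} t * t ^ k :: real)) \<partial>\<nu>)
        = (\<integral>\<^sup>+t\<in>{0<..}. ennreal (t ^ k) \<partial>\<nu>)"
      by (intro nn_integral_cong) (auto simp: indicator_def)
    then show "(\<integral>\<^sup>+t. ennreal (norm (indicator {0<..} t * t ^ k :: real)) \<partial>\<nu>) < \<infinity>"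
      using fin by simp
  qed
  ultimately have "integrable \<nu> g"
    unfolding g_def by (intro Bochner_Integration.integrable_add integrable_mult_right)
  then have "integrable \<nu> F"
    using Fm by (rule Bochner_Integration.integrable_bound) (auto simp: F0 intro: order.trans[OF le abs_ge_self])
  then show ?thesis by (simp add: F_def[abs_def])
qed

section \<open>Transformation rules and additivity of the integrand\<close>

lemma closure_affine_image:
  fixes L :: "'a::euclidean_space \<Rightarrow> 'a"
  assumes "linear L" "inj L"
  shows "closure ((\<lambda>x. L x + b) ` A) = (\<lambda>x. L x + b) ` closure A"
proof -
  have "(\<lambda>x. L x + b) ` B = (+) b ` (L ` B)" for B
    by (auto simp: image_image add.commute)
  then show ?thesis
    using closure_injective_linear_image[OF assms] by (simp add: closure_translation)
qed

lemma intrinsic_volume_sublevel_rigid: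
  fixes T :: "real^'n \<Rightarrow> real^'n"
  assumes u: "u \<in> conv_funs" and T: "rigid_motion T"
  shows "u \<circ> T \<in> conv_funs"
    and "intrinsic_volume k (closure {x. (u \<circ> T) x < ereal t})
       = intrinsic_volume k (closure {x. u x < ereal t})"
proof -
  obtain R c where R: "orthogonal_matrix R" and T: "T = (\<lambda>x. R *v x + c)"
    using T by (auto simp: rigid_motion_def)
  \<comment> \<open>\<open>L x + b\<close> is the inverse rigid motion, which maps sublevel sets of
    u to those of \<open>u \<circ> T\<close>.\<close>
  define L where "L = (\<lambda>x. transpose R *v x)"
  define b where "b = - (L c)"
  have RR: "R ** transpose R = mat 1" "transpose R ** R = mat 1"
    using R by (auto simp: orthogonal_matrix_def)
  have lin: "linear L" unfolding L_def by (rule matrix_vector_mul_linear)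
  have orth: "orthogonal_transformation L"
    using R lin unfolding L_def
    by (simp add: orthogonal_transformation_matrix orthogonal_matrix_transpose del: transpose_matrix_vector)
  have inv: "L (T x) + b = x" "T (L x + b) = x" for x
    by (simp_all add: L_def T b_def matrix_vector_right_distrib matrix_vector_mul_assoc RR
        matrix_vector_mult_diff_distrib vec.neg
        del: transpose_matrix_vector)
  have "(\<lambda>x. u (T x)) \<in> conv_funs"
  proof (rule conv_funs_compose_affine[OF u, where S = "\<lambda>x. L x + b"])
    show "T (s *\<^sub>R x + (1 - s) *\<^sub>R y) = s *\<^sub>R T x + (1 - s) *\<^sub>R T y" for x y s
      by (simp add: T matrix_vector_right_distrib matrix_vector_mult_scaleR algebra_simps)
    show "continuous_on UNIV (\<lambda>x. L x + b)"
      using lin linear_continuous_on linear_conv_bounded_linear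
      by (intro continuous_on_add continuous_on_const) blast
  qed (use inv in auto)
  then show "u \<circ> T \<in> conv_funs" by (simp add: comp_def)
  have "{x. (u \<circ> T) x < ereal t} = (\<lambda>x. L x + b) ` {x. u x < ereal t}"
    using inv by (auto simp: image_iff) metis
  then have "closure {x. (u \<circ> T) x < ereal t} = (\<lambda>x. L x + b) ` closure {x. u x < ereal t}"
    using closure_affine_image[OF lin orthogonal_transformation_inj[OF orth]] by simp
  then show "intrinsic_volume k (closure {x. (u \<circ> T) x < ereal t})
       = intrinsic_volume k (closure {x. u x < ereal t})"
    by (simp add: intrinsic_volume_rigid_image[OF orth] compact_convex_closure_sublevel[OF u])
qed

lemma intrinsic_volume_sublevel_scaleR:
  fixes u :: "real^'n \<Rightarrow> ereal"
  assumes u: "u \<in> conv_funs" and c: "c > 0"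
  shows "(\<lambda>x. u (x /\<^sub>R c)) \<in> conv_funs"
    and "intrinsic_volume k (closure {x. u (x /\<^sub>R c) < ereal t})
       = c ^ k * intrinsic_volume k (closure {x. u x < ereal t})"
proof -
  show "(\<lambda>x. u (x /\<^sub>R c)) \<in> conv_funs"
    using c by (intro conv_funs_compose_affine[OF u, where S = "(*\<^sub>R) c"])
      (auto intro: continuous_intros simp: algebra_simps)
  have "{x. u (x /\<^sub>R c) < ereal t} = (*\<^sub>R) c ` {x. u x < ereal t}"
    using c by (auto simp: image_iff intro!: exI[of _ "_ /\<^sub>R c"])
  then show "intrinsic_volume k (closure {x. u (x /\<^sub>R c) < ereal t})
       = c ^ k * intrinsic_volume k (closure {x. u x < ereal t})"
    using c by (simp add: closure_scaleR[symmetric] intrinsic_volume_scaleR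
        compact_convex_closure_sublevel[OF u])
qed

text \<open>Closure commutes with finite unions, and the union is convex since the minimum lies in
  the class; so additivity of V_k applies to the two closures.\<close>

lemma intrinsic_volume_sublevel_valuation:
  assumes u: "u \<in> conv_funs" and v: "v \<in> conv_funs"
    and w: "(\<lambda>x. min (u x) (v x)) \<in> conv_funs"
  shows "intrinsic_volume k (closure {x. max (u x) (v x) < ereal t})
       + intrinsic_volume k (closure {x. min (u x) (v x) < ereal t})
       = intrinsic_volume k (closure {x. u x < ereal t}) + intrinsic_volume k (closure {x. v x < ereal t})"
proof -
  have "{x. min (u x) (v x) < ereal t} = {x. u x < ereal t} \<union> {x. v x < ereal t}"
    by (auto simp: min_less_iff_disj)
  then have Un: "closure {x. min (u x) (v x) < ereal t}
      = closure {x. u x < ereal t} \<union> closure {x. v x < ereal t}"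
    by simp
  moreover have "convex (closure {x. min (u x) (v x) < ereal t})"
    using compact_convex_closure_sublevel[OF w] by (simp add: compact_convex_def)
  ultimately show ?thesis
    using intrinsic_volume_Un_Int[of "closure {x. u x < ereal t}" "closure {x. v x < ereal t}" k]
      compact_convex_closure_sublevel[OF u] compact_convex_closure_sublevel[OF v]
    unfolding closure_sublevel_max[OF assms] by simp
qed

theorem corollary6p3:
  fixes \<nu> :: "real measure" and k :: nat
    and \<mu> :: "(real^'n \<Rightarrow> ereal) \<Rightarrow> real"
  assumes "k \<le> CARD('n)"
    and "radon_measure \<nu>"
    and "(\<integral>\<^sup>+t\<in>{0<..}. ennreal (t ^ k) \<partial>\<nu>) < \<infinity>"
    and "\<And>u. u \<in> conv_funs \<Longrightarrow>
           \<mu> u = (\<integral>t. intrinsic_volume k (closure {x. u x < ereal t}) \<partial>\<nu>)"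
  shows "(\<forall>u\<in>(conv_funs :: (real^'n \<Rightarrow> ereal) set).
             integrable \<nu> (\<lambda>t. intrinsic_volume k (closure {x. u x < ereal t})))
       \<and> valuation \<mu>
       \<and> rigid_motion_invariant \<mu>
       \<and> monotone_decreasing \<mu>
       \<and> homogeneous_of_degree k \<mu>
       \<and> m_continuous \<mu>"
proof -
  define F where "F u t = intrinsic_volume k (closure {x. u x < ereal t})"
    for u :: "real^'n \<Rightarrow> ereal" and t
  have int: "integrable \<nu> (F u)" if "u \<in> conv_funs" for u
    using integrable_intrinsic_volume_sublevel[OF assms(2,3) that] by (simp add: F_def[abs_def])
  have \<mu>: "\<mu> u = (\<integral>t. F u t \<partial>\<nu>)" if "u \<in> conv_funs" for u
    using assms(4)[OF that] by (simp add: F_def)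
  have F_le: "F u t \<le> F v t" if "u \<in> conv_funs" "v \<in> conv_funs" "\<And>x. v x \<le> u x" for u v t
    unfolding F_def using that
    by (intro intrinsic_volume_mono compact_convex_closure_sublevel closure_mono)
       (auto intro: le_less_trans)
  have "valuation \<mu>"
    unfolding valuation_def
  proof (intro conjI ballI impI)
    show "\<mu> (\<lambda>x. \<infinity>) = 0"
      by (simp add: \<mu> conv_funs_infinity F_def intrinsic_volume_empty)
  next
    fix u v :: "real^'n \<Rightarrow> ereal"
    assume uv: "u \<in> conv_funs" "v \<in> conv_funs" and w: "(\<lambda>x. min (u x) (v x)) \<in> conv_funs"
    \<comment> \<open>Only the minimum is assumed to lie in the class; membership of the maximum
      supplies its integrability.\<close>
    note max = conv_funs_max[OF uv]
    have "\<mu> (\<lambda>x. max (u x) (v x)) + \<mu> (\<lambda>x. min (u x) (v x))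
        = (\<integral>t. F (\<lambda>x. max (u x) (v x)) t + F (\<lambda>x. min (u x) (v x)) t \<partial>\<nu>)"
      by (simp add: \<mu> int max w)
    also have "\<dots> = (\<integral>t. F u t + F v t \<partial>\<nu>)"
      unfolding F_def by (simp only: intrinsic_volume_sublevel_valuation[OF uv w])
    also have "\<dots> = \<mu> u + \<mu> v"
      by (simp add: \<mu> int uv)
    finally show "\<mu> (\<lambda>x. max (u x) (v x)) + \<mu> (\<lambda>x. min (u x) (v x)) = \<mu> u + \<mu> v" .
  qed
  moreover have "rigid_motion_invariant \<mu>"
    unfolding rigid_motion_invariant_def
  proof (intro ballI allI impI)
    fix u :: "real^'n \<Rightarrow> ereal" and T :: "real^'n \<Rightarrow> real^'n"
    assume "u \<in> conv_funs" "rigid_motion T"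
    then show "\<mu> (u \<circ> T) = \<mu> u"
      using \<mu>[of u] \<mu>[of "u \<circ> T"] intrinsic_volume_sublevel_rigid[of u T] by (simp add: F_def)
  qed
  moreover have "monotone_decreasing \<mu>"
    unfolding monotone_decreasing_def
    by (auto simp: \<mu> intro!: integral_mono int F_le)
  moreover have "homogeneous_of_degree k \<mu>"
    unfolding homogeneous_of_degree_def
    by (auto simp: \<mu> F_def intrinsic_volume_sublevel_scaleR)
  moreover have "m_continuous \<mu>"
    unfolding m_continuous_def
  proof (intro ballI allI impI)
    fix u :: "real^'n \<Rightarrow> ereal" and U :: "nat \<Rightarrow> real^'n \<Rightarrow> ereal"
    assume u: "u \<in> conv_funs" and "\<forall>i. U i \<in> conv_funs"
      and "\<forall>i x. U (Suc i) x \<le> U i x \<and> u x \<le> U (Suc i) x"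
      and lim: "\<forall>x\<in>rel_interior (eff_dom u). (\<lambda>i. U i x) \<longlonglongrightarrow> u x"
    then have U: "U i \<in> conv_funs" and dec: "U (Suc i) x \<le> U i x" and "u x \<le> U (Suc i) x" for i x
      by auto
    then have ge: "u x \<le> U i x" for i x
      by (meson order.trans)
    \<comment> \<open>Pointwise convergence holds at every t, so no exceptional null set for \<nu>
      arises.\<close>
    have "(\<lambda>i. F (U i) t) \<longlonglongrightarrow> F u t" for t
      unfolding F_def
    proof (rule intrinsic_volume_incseq)
      show "closure (\<Union>i. closure {x. U i x < ereal t}) = closure {x. u x < ereal t}"
        using u ge lim by (intro closure_UN_sublevels) auto
      show "incseq (\<lambda>i. closure {x. U i x < ereal t})"
        using dec by (intro incseq_SucI closure_mono) (auto intro: le_less_trans)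
    qed (intro compact_convex_closure_sublevel U u)+
    moreover have "norm (F (U i) t) \<le> F u t" for i t
      using F_le[OF U u ge] intrinsic_volume_sublevel_nonneg[OF U] by (simp add: F_def)
    ultimately have "(\<lambda>i. \<integral>t. F (U i) t \<partial>\<nu>) \<longlonglongrightarrow> (\<integral>t. F u t \<partial>\<nu>)"
      using int[OF u] int[OF U] borel_measurable_integrable
      by (intro integral_dominated_convergence[where w = "F u"]) auto
    then show "(\<lambda>i. \<mu> (U i)) \<longlonglongrightarrow> \<mu> u"
      by (simp add: \<mu> U u)
  qed
  ultimately show ?thesis
    using integrable_intrinsic_volume_sublevel[OF assms(2,3)] by blast
qed

end
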